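(* Let $n,k,Q$ be positive integers, let $B\subseteq\mathbb R^n$ be a Lebesgue measurable set without isolated points, and let $f\colon B\to\mathcal A_Q(\mathbb R^k)$ be a measurable function. Define, for $x\in B$, $$\operatorname{Lip} f(x)=\limsup_{y\in B,\ y\to x}\frac{\mathcal G\big(f(y),f(x)\big)}{|y-x|},\qquad A_f=\{x\in B:\ \operatorname{Lip} f(x)<+\infty\}.$$ Then $f$ is differentiable at Lebesgue-almost every point of $A_f$.
   Context: $\mathcal A_Q(\mathbb R^k)$ denotes the set of unordered $Q$-tuples of points of $\mathbb R^k$, i.e. measures of the form $\sum_{i=1}^Q[\![P_i]\!]$ (sum of $Q$ Dirac masses, not necessarily distinct). It is equipped with the metric $\mathcal G\big(\sum_i[\![A_i]\!],\sum_i[\![B_i]\!]\big)=\min_{\sigma}\sqrt{\sum_{i=1}^Q |A_i-B_{\sigma(i)}|^2}$, the minimum taken over all permutations $\sigma$ of $\{1,\dots,Q\}$; measurability of $f$ refers to the Borel $\sigma$-algebra of this metric space. A function $f\colon B\to\mathcal A_Q(\mathbb R^k)$ is differentiable at $x\in B$ with $f(x)=\sum_{i=1}^Q[\![P_i]\!]$ if there exist $k\times n$ matrices $M_1,\dots,M_Q$ such that, setting $F(z)=\sum_{i=1}^Q[\![P_i+M_iz]\!]$, one has $\lim_{y\in B,\ y\to x}\mathcal G\big(f(y),F(y-x)\big)/|y-x|=0$, and moreover $P_i=P_j$ implies $M_i=M_j$. *)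

theory Defs
  imports "HOL-Analysis.Analysis" "HOL-Library.Multiset" "HOL-Library.Liminf_Limsup"
begin

definition AQ :: "nat \<Rightarrow> 'a multiset set" where
  "AQ Q = {P. size P = Q}"

text \<open>The metric G: minimum over all matchings (orderings) of the l2 distance.
  Writing P = mset xs and R = mset ys, varying ys over all orderings realises all permutations.\<close>
definition Gdist :: "('a::real_normed_vector) multiset \<Rightarrow> 'a multiset \<Rightarrow> real" where
  "Gdist P R = Min ((\<lambda>(xs, ys). sqrt (sum_list (map (\<lambda>(a, b). (norm (a - b))\<^sup>2) (zip xs ys))))
                    ` {(xs, ys). mset xs = P \<and> mset ys = R})"

definition Gopen :: "nat \<Rightarrow> ('a::real_normed_vector) multiset set \<Rightarrow> bool" where
  "Gopen Q U \<longleftrightarrow> U \<subseteq> AQ Q \<and>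
     (\<forall>P\<in>U. \<exists>e>0. \<forall>R\<in>AQ Q. Gdist P R < e \<longrightarrow> R \<in> U)"

text \<open>Measurability of f : B \<rightarrow> A_Q(R^k) (B Lebesgue measurable): preimages of open sets
  (generators of the Borel sigma-algebra) are Lebesgue measurable.\<close>
definition AQ_measurable :: "nat \<Rightarrow> ('n::euclidean_space) set \<Rightarrow> ('n \<Rightarrow> ('a::real_normed_vector) multiset) \<Rightarrow> bool" where
  "AQ_measurable Q B f \<longleftrightarrow> (\<forall>U. Gopen Q U \<longrightarrow> {x\<in>B. f x \<in> U} \<in> sets lebesgue)"

definition Lip_pt :: "('n::euclidean_space) set \<Rightarrow> ('n \<Rightarrow> ('a::real_normed_vector) multiset) \<Rightarrow> 'n \<Rightarrow> ereal" where
  "Lip_pt B f x = Limsup (at x within B) (\<lambda>y. ereal (Gdist (f y) (f x) / norm (y - x)))"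

definition AQ_differentiable_at ::
  "nat \<Rightarrow> (real^'n) set \<Rightarrow> (real^'n \<Rightarrow> (real^'k) multiset) \<Rightarrow> real^'n \<Rightarrow> bool" where
  "AQ_differentiable_at Q B f x \<longleftrightarrow>
     (\<exists>(Ps :: nat \<Rightarrow> real^'k) (Ms :: nat \<Rightarrow> real^'n^'k).
        f x = mset (map Ps [0..<Q]) \<and>
        (\<forall>i<Q. \<forall>j<Q. Ps i = Ps j \<longrightarrow> Ms i = Ms j) \<and>
        ((\<lambda>y. Gdist (f y) (mset (map (\<lambda>i. Ps i + Ms i *v (y - x)) [0..<Q])) / norm (y - x))
            \<longlongrightarrow> 0) (at x within B))"

end

theory Submission
  imports Defs
begin

text \<open>
  Almost every point of an arbitrary, possibly nonmeasurable set \<open>E\<close> is a nonporous point of \<open>E\<close>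
  (a substitute for Lebesgue density, from the Vitali covering theorem). This gives Rademacher's theorem in
  Stepanov's manner: a Lipschitz function has partial derivatives almost everywhere, and on countably many sets
  these are uniform up to an error; at a nonporous point of such a set one can walk from \<open>x\<close> to \<open>x + h\<close>
  coordinate by coordinate.

  For a \<open>Q\<close>-valued \<open>f\<close>, the set \<open>A\<^sub>f\<close> is a countable union of small pieces \<open>S\<close> on which
  \<open>\<G>(f(y), f(x)) \<le> j|y - x|\<close> for all \<open>x \<in> S\<close> and all nearby \<open>y \<in> B\<close>, and whose values have the same
  multiplicities at points close to fixed, well separated centres. On \<open>S\<close> the values split into Lipschitz
  sheets. At a nonporous point \<open>x\<close> of \<open>S\<close> at which all sheets are differentiable relative to \<open>S\<close>, every
  nearby \<open>y \<in> B\<close> is within \<open>\<epsilon>|y - x|\<close> of some \<open>z \<in> S\<close>, which carries the first order expansion over to \<open>B\<close>.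
\<close>

section \<open>Porous points\<close>

text \<open>Let \<open>m\<close> be the outer measure of \<open>S\<close>, finite because
  \<open>S\<close> is bounded. Open supersets have measure arbitrarily close to \<open>m\<close>, so
  \<open>shrink\<close> gives \<open>m \<le> c * m\<close>, and \<open>c < 1\<close> forces
  \<open>m = 0\<close>. Both Vitali arguments below end with this lemma, which needs no
  measurability of \<open>S\<close>.\<close>

lemma negligible_by_contraction:
  fixes S :: "'a::euclidean_space set"
  assumes "bounded S" "0 \<le> c" "c < 1"
    and shrink: "\<And>U. open U \<Longrightarrow> U \<in> lmeasurable \<Longrightarrow> S \<subseteq> U \<Longrightarrow>
      \<exists>T. T \<in> lmeasurable \<and> S \<subseteq> T \<and> measure lebesgue T \<le> c * measure lebesgue U"
  shows "negligible S"
proof -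
  define X where "X = measure lebesgue ` {T. T \<in> lmeasurable \<and> S \<subseteq> T}"
  define m where "m = Inf X"
  obtain B where "S \<subseteq> ball 0 B"
    using bounded_subset_ballD[OF \<open>bounded S\<close>] by auto
  then have ne: "X \<noteq> {}"
    unfolding X_def using lmeasurable_ball[of 0 B] by blast
  have bdd: "bdd_below X"
    unfolding X_def by (intro bdd_belowI[of _ 0]) auto
  have le: "m \<le> measure lebesgue T" if "T \<in> lmeasurable" "S \<subseteq> T" for T
    unfolding m_def using that bdd by (intro cInf_lower) (auto simp: X_def)
  have "m \<ge> 0"
    unfolding m_def using ne by (intro cInf_greatest) (auto simp: X_def)
  have step: "m \<le> c * m + e" if "e > 0" for e
  proof -
    obtain T where T: "T \<in> lmeasurable" "S \<subseteq> T" "measure lebesgue T < m + e / 2"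
    proof -
      have "\<exists>x\<in>X. x < m + e / 2"
        unfolding m_def using ne \<open>e > 0\<close> bdd by (intro iffD1[OF cInf_less_iff]) auto
      with that show ?thesis unfolding X_def by blast
    qed
    obtain U where U: "open U" "T \<subseteq> U" "U \<in> lmeasurable" "measure lebesgue U < measure lebesgue T + e / 2"
    proof -
      obtain U where U: "open U" "T \<subseteq> U" "U - T \<in> lmeasurable" "emeasure lebesgue (U - T) < ennreal (e/2)"
        using sets_lebesgue_outer_open[OF fmeasurableD[OF T(1)], of "e/2"] \<open>e > 0\<close> by auto
      have "measure lebesgue (U - T) < e/2"
        using U \<open>e > 0\<close> by (simp add: emeasure_eq_measure2 ennreal_less_iff)
      moreover have eq: "U = T \<union> (U - T)"
        using U by auto
      moreover have "U \<in> lmeasurable"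
        using fmeasurable.Un[OF T(1) U(3)] eq by simp
      moreover have "measure lebesgue U = measure lebesgue T + measure lebesgue (U - T)"
        using measure_Un2[OF T(1) \<open>U \<in> lmeasurable\<close>] U(2) by (simp add: Un_absorb1)
      ultimately show ?thesis
        using that U by auto
    qed
    obtain T' where T': "T' \<in> lmeasurable" "S \<subseteq> T'" "measure lebesgue T' \<le> c * measure lebesgue U"
      using shrink[of U] U T by blast
    have "m \<le> c * measure lebesgue U"
      using le T' by fastforce
    also have "\<dots> \<le> c * (m + e)"
      using T U \<open>0 \<le> c\<close> by (intro mult_left_mono) auto
    also have "\<dots> \<le> c * m + e"
      using \<open>c < 1\<close> \<open>e > 0\<close> by (simp add: algebra_simps)
    finally show ?thesis .
  qed
  then have "m \<le> c * m"
    by (rule field_le_epsilon)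
  then have "m = 0"
    using \<open>m \<ge> 0\<close> \<open>c < 1\<close> by (metis less_eq_real_def mult_le_cancel_right1 not_le)
  show ?thesis
    unfolding negligible_outer
  proof (intro allI impI)
    fix e :: real assume "e > 0"
    then have "\<exists>x\<in>X. x < e"
      using ne bdd \<open>m = 0\<close> unfolding m_def by (intro iffD1[OF cInf_less_iff]) auto
    then show "\<exists>T. S \<subseteq> T \<and> T \<in> lmeasurable \<and> measure lebesgue T < e"
      unfolding X_def by blast
  qed
qed

lemma negligible_if_bounded_parts:
  fixes S :: "'a::euclidean_space set"
  assumes "\<And>T. T \<subseteq> S \<Longrightarrow> bounded T \<Longrightarrow> negligible T"
  shows "negligible S"
  unfolding negligible_on_intervals[of S]
  by (meson assms bounded_Int bounded_cbox inf_le1)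

text \<open>Each point of \<open>S\<close> lies on the boundary of arbitrarily small balls whose
  concentric balls, shrunk by the factor \<open>e\<close>, miss \<open>E\<close>. A disjoint Vitali
  subfamily inside \<open>U\<close> covers almost all of \<open>P\<close>, and deleting the holes
  loses the fraction \<open>e ^ DIM('a)\<close> of its volume. This is a contraction with factor
  \<open>1 - e ^ DIM('a)\<close>.\<close>

lemma negligible_uniformly_porous:
  fixes S E :: "'a::euclidean_space set"
  assumes e: "0 < e" "e \<le> 1" and "S \<subseteq> E"
    and holes: "\<And>x d. x \<in> S \<Longrightarrow> 0 < d \<Longrightarrow> \<exists>y. 0 < dist y x \<and> dist y x < d \<and> E \<inter> ball y (e * dist y x) = {}"
  shows "negligible S"
proof (rule negligible_if_bounded_parts)
  fix P assume P: "P \<subseteq> S" "bounded P"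
  let ?\<mu> = "measure (lebesgue :: 'a measure)"
  define c where "c = 1 - e ^ DIM('a)"
  show "negligible P"
  proof (rule negligible_by_contraction)
    show "bounded P" "0 \<le> c" "c < 1"
      using P e by (auto simp: c_def power_le_one)
    fix U :: "'a set"
    assume U: "open U" "U \<in> lmeasurable" "P \<subseteq> U"
    define K where "K = {(y,r). 0 < r \<and> cball y r \<subseteq> U \<and> E \<inter> ball y (e * r) = {}}"
    have K1: "0 < snd i" if "i \<in> K" for i
      using that by (auto simp: K_def)
    have K2: "\<exists>i. i \<in> K \<and> x \<in> cball (fst i) (snd i) \<and> snd i < d" if "x \<in> P" "0 < d" for x d
    proof -
      obtain k where k: "k > 0" "ball x k \<subseteq> U"
        using U \<open>x \<in> P\<close> by (meson openE subsetD)
      obtain y where y: "0 < dist y x" "dist y x < min d (k/2)" "E \<inter> ball y (e * dist y x) = {}"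
        using holes[OF subsetD[OF P(1) \<open>x \<in> P\<close>], of "min d (k/2)"] \<open>0 < d\<close> k by auto
      have "cball y (dist y x) \<subseteq> ball x k"
      proof
        fix z assume "z \<in> cball y (dist y x)"
        then show "z \<in> ball x k"
          using y dist_triangle[of x z y] by (simp add: dist_commute)
      qed
      then show ?thesis
        using y k by (intro exI[of _ "(y, dist y x)"]) (auto simp: K_def)
    qed
    obtain C where C: "countable C" "C \<subseteq> K"
      and pw: "pairwise (\<lambda>i j. disjnt (cball (fst i) (snd i)) (cball (fst j) (snd j))) C"
      and neg: "negligible (P - (\<Union>i\<in>C. cball (fst i) (snd i)))"
      by (rule Vitali_covering_theorem_cballs[of K snd P fst, OF K1 K2])
    \<comment> \<open>Only the shells around the holes are kept. They still cover \<open>P\<close>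
      up to the Vitali remainder, since \<open>P\<close> lies in \<open>E\<close> and the holes miss
      \<open>E\<close>; the null remainder is put back into \<open>T\<close>.\<close>
    define A where "A i = cball (fst i) (snd i) - ball (fst i) (e * snd i)" for i :: "'a \<times> real"
    define T where "T = (\<Union>i\<in>C. A i) \<union> (P - (\<Union>i\<in>C. cball (fst i) (snd i)))"
    have Am: "A i \<in> lmeasurable" for i
      unfolding A_def by (intro fmeasurable.Diff) auto
    have Ameas: "?\<mu> (A i) = c * ?\<mu> (cball (fst i) (snd i))" if "i \<in> K" for i
    proof -
      have r: "snd i > 0" using K1 that by auto
      have sub: "ball (fst i) (e * snd i) \<subseteq> cball (fst i) (snd i)"
        using e r by (intro order_trans[OF ball_subset_cball]) (simp add: mult_le_cancel_right1 subset_cball)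
      have "?\<mu> (A i) = ?\<mu> (cball (fst i) (snd i)) - ?\<mu> (ball (fst i) (e * snd i))"
        unfolding A_def using sub by (intro measurable_measure_Diff) auto
      also have "?\<mu> (ball (fst i) (e * snd i)) = e ^ DIM('a) * ?\<mu> (cball (fst i) (snd i))"
        using e r content_ball_conv_unit_ball[of "e * snd i" "fst i"] content_ball_conv_unit_ball[of "snd i" "fst i"]
        by (simp add: power_mult_distrib content_cball_conv_ball)
      finally show ?thesis by (simp add: c_def algebra_simps)
    qed
    have CU: "cball (fst i) (snd i) \<subseteq> U" if "i \<in> C" for i
      using subsetD[OF C(2) that] by (simp add: K_def split_beta)
    have bound: "?\<mu> (\<Union>i\<in>I. A i) \<le> c * ?\<mu> U" if I: "I \<subseteq> C" "finite I" for I
    proof -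
      have "?\<mu> (\<Union>i\<in>I. A i) \<le> (\<Sum>i\<in>I. ?\<mu> (A i))"
        using I Am by (intro measure_UNION_le) auto
      also have "\<dots> = c * (\<Sum>i\<in>I. ?\<mu> (cball (fst i) (snd i)))"
        unfolding sum_distrib_left using I C by (intro sum.cong refl Ameas) blast
      also have "(\<Sum>i\<in>I. ?\<mu> (cball (fst i) (snd i))) = ?\<mu> (\<Union>i\<in>I. cball (fst i) (snd i))"
        using I pw by (intro measure_UNION'[symmetric]) (auto elim: pairwise_mono)
      also have "c * \<dots> \<le> c * ?\<mu> U"
      proof (intro mult_left_mono measure_mono_fmeasurable)
        show "(\<Union>i\<in>I. cball (fst i) (snd i)) \<subseteq> U"
          using CU I(1) by blast
      qed (use I U \<open>0 \<le> c\<close> in \<open>auto intro!: sets.finite_UN\<close>)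
      finally show ?thesis .
    qed
    have UA: "(\<Union>i\<in>C. A i) \<in> lmeasurable" "?\<mu> (\<Union>i\<in>C. A i) \<le> c * ?\<mu> U"
      using Am bound
      by (auto intro!: fmeasurable_UN_bound[OF \<open>countable C\<close>] measure_UN_bound[OF \<open>countable C\<close>])
    have "?\<mu> T = ?\<mu> (\<Union>i\<in>C. A i)"
      unfolding T_def by (intro measure_negligible_symdiff[OF UA(1)] negligible_subset[OF neg]) auto
    moreover have "T \<in> lmeasurable"
      unfolding T_def by (intro fmeasurable.Un UA(1) negligible_imp_measurable[OF neg])
    moreover have "P \<subseteq> T"
    proof
      fix x assume "x \<in> P"
      moreover have "x \<notin> ball (fst i) (e * snd i)" if "i \<in> C" for i
        using subsetD[OF C(2) that] subsetD[OF \<open>S \<subseteq> E\<close> subsetD[OF P(1) \<open>x \<in> P\<close>]]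
        by (auto simp: K_def split_beta disjoint_iff)
      ultimately show "x \<in> T"
        unfolding T_def A_def by blast
    qed
    ultimately show "\<exists>T. T \<in> lmeasurable \<and> P \<subseteq> T \<and> ?\<mu> T \<le> c * ?\<mu> U"
      using UA(2) by auto
  qed
qed

text \<open>Near \<open>x\<close> the set leaves no hole of size proportional to the distance from
  \<open>x\<close>. A measurable set has this property at each of its density points, but the
  condition itself makes sense for arbitrary sets. Taking \<open>y = x\<close> shows that
  \<open>x\<close> belongs to \<open>E\<close>.\<close>

definition nonporous_at :: "'a::metric_space set \<Rightarrow> 'a \<Rightarrow> bool" where
  "nonporous_at E x \<longleftrightarrow>
    (\<forall>e>0. \<exists>d>0. \<forall>y. dist y x < d \<longrightarrow> (\<exists>z\<in>E. dist z y \<le> e * dist y x))"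

text \<open>The hole ratio at a porous point can be decreased to some
  \<open>inverse (real (Suc k))\<close>, so the porous points form a countable union of uniformly
  porous sets.\<close>

lemma negligible_porous_points:
  fixes E :: "'a::euclidean_space set"
  shows "negligible {x\<in>E. \<not> nonporous_at E x}"
proof -
  define S where "S k = {x\<in>E. \<forall>d>0. \<exists>y. 0 < dist y x \<and> dist y x < d \<and>
    E \<inter> ball y (inverse (real (Suc k)) * dist y x) = {}}" for k
  have "negligible (S k)" for k
    by (rule negligible_uniformly_porous[of "inverse (real (Suc k))" _ E])
      (auto simp: S_def field_simps)
  then have "negligible (\<Union>k. S k)" by auto
  moreover have "{x\<in>E. \<not> nonporous_at E x} \<subseteq> (\<Union>k. S k)"
  proof
    fix x assume "x \<in> {x\<in>E. \<not> nonporous_at E x}"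
    then obtain e where x: "x \<in> E" and "e > 0"
      and e: "\<And>d. d > 0 \<Longrightarrow> \<exists>y. dist y x < d \<and> (\<forall>z\<in>E. dist z y > e * dist y x)"
      unfolding nonporous_at_def by (auto simp: not_le)
    obtain k where k: "inverse (real (Suc k)) < e"
      using \<open>e > 0\<close> reals_Archimedean by blast
    have "\<exists>y. 0 < dist y x \<and> dist y x < d \<and> E \<inter> ball y (inverse (real (Suc k)) * dist y x) = {}"
      if d: "d > 0" for d
    proof -
      obtain y where y: "dist y x < d" "\<And>z. z \<in> E \<Longrightarrow> dist z y > e * dist y x"
        using e d by blast
      have "0 < dist y x"
        using y(2)[OF x] by auto
      moreover have "E \<inter> ball y (inverse (real (Suc k)) * dist y x) = {}"
      proof -
        have "inverse (real (Suc k)) * dist y x \<le> e * dist y x"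
          using k by (intro mult_right_mono) auto
        then show ?thesis
          using y(2) by (fastforce simp: dist_commute)
      qed
      ultimately show ?thesis using y(1) by blast
    qed
    with x show "x \<in> (\<Union>k. S k)" unfolding S_def by blast
  qed
  ultimately show ?thesis by (rule negligible_subset)
qed

section \<open>Differentiation of Lipschitz functions\<close>

lemma emeasure_disjoint_cballs:
  fixes a :: "'i \<Rightarrow> 'a::euclidean_space"
  assumes "sets M = sets borel" "countable C"
    and "pairwise (\<lambda>i j. disjnt (cball (a i) (r i)) (cball (a j) (r j))) C"
  shows "emeasure M (\<Union>i\<in>C. cball (a i) (r i)) = (\<integral>\<^sup>+i. emeasure M (cball (a i) (r i)) \<partial>count_space C)"
  using assms by (intro emeasure_UN_countable)
    (auto simp: disjoint_family_on_def pairwise_def disjnt_def)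

text \<open>Vitali's theorem is applied twice: first to balls in \<open>U\<close> of mean density at
  most \<open>p\<close>, then, inside these, to balls of mean density at least \<open>q\<close>. The
  second family still covers almost all of \<open>P\<close>, and comparing \<open>M\<close>-masses
  bounds its volume by \<open>p / q\<close> times that of \<open>U\<close>. The balls need only
  contain \<open>x\<close>, not be centred there, so one-sided intervals are allowed.\<close>

lemma negligible_of_density_gap:
  fixes S :: "'a::euclidean_space set" and M :: "'a measure" and p q :: real
  assumes M: "sets M = sets borel" and pq: "0 < p" "p < q"
    and lo: "\<And>x d. x \<in> S \<Longrightarrow> 0 < d \<Longrightarrow>
      \<exists>y r. 0 < r \<and> r < d \<and> x \<in> cball y r \<and> emeasure M (cball y r) \<le> ennreal p * emeasure lborel (cball y r)"
    and hi: "\<And>x d. x \<in> S \<Longrightarrow> 0 < d \<Longrightarrow>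
      \<exists>y r. 0 < r \<and> r < d \<and> x \<in> cball y r \<and> emeasure M (cball y r) \<ge> ennreal q * emeasure lborel (cball y r)"
  shows "negligible S"
proof (rule negligible_if_bounded_parts)
  fix P assume P: "P \<subseteq> S" "bounded P"
  let ?\<mu> = "measure (lebesgue :: 'a measure)"
  let ?B = "\<lambda>i::'a \<times> real. cball (fst i) (snd i)"
  have cover: "\<exists>C. countable C \<and> C \<subseteq> {i. 0 < snd i \<and> ?B i \<subseteq> U \<and> R (?B i)} \<and>
      pairwise (\<lambda>i j. disjnt (?B i) (?B j)) C \<and> negligible (X - (\<Union>i\<in>C. ?B i))"
    if "open U" "X \<subseteq> U" and R: "\<And>x d. x \<in> X \<Longrightarrow> 0 < d \<Longrightarrow> \<exists>y r. 0 < r \<and> r < d \<and> x \<in> cball y r \<and> R (cball y r)"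
    for U X :: "'a set" and R
  proof -
    have *: "\<exists>i. i \<in> {i. 0 < snd i \<and> ?B i \<subseteq> U \<and> R (?B i)} \<and> x \<in> ?B i \<and> snd i < d" if "x \<in> X" "0 < d" for x d
    proof -
      obtain k where k: "k > 0" "ball x k \<subseteq> U"
        using \<open>open U\<close> \<open>X \<subseteq> U\<close> \<open>x \<in> X\<close> by (meson openE subsetD)
      obtain y r where y: "0 < r" "r < min d (k/2)" "x \<in> cball y r" "R (cball y r)"
        using R[OF \<open>x \<in> X\<close>, of "min d (k/2)"] \<open>0 < d\<close> k by auto
      have "cball y r \<subseteq> ball x k"
      proof
        fix z assume "z \<in> cball y r"
        then show "z \<in> ball x k"
          using y dist_triangle[of x z y] by (simp add: dist_commute)
      qed
      then show ?thesis
        using y k by (intro exI[of _ "(y, r)"]) auto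
    qed
    show ?thesis
      by (rule Vitali_covering_theorem_cballs[of "{i. 0 < snd i \<and> ?B i \<subseteq> U \<and> R (?B i)}" snd X fst, OF _ *]) auto
  qed
  show "negligible P"
  proof (rule negligible_by_contraction)
    show "bounded P" "0 \<le> p / q" "p / q < 1"
      using P pq by auto
    fix U :: "'a set"
    assume U: "open U" "U \<in> lmeasurable" "P \<subseteq> U"
    obtain C where C: "countable C" "C \<subseteq> {i. 0 < snd i \<and> ?B i \<subseteq> U \<and> emeasure M (?B i) \<le> ennreal p * emeasure lborel (?B i)}"
      and pwC: "pairwise (\<lambda>i j. disjnt (?B i) (?B j)) C" and negC: "negligible (P - (\<Union>i\<in>C. ?B i))"
      using cover[OF U(1,3), of "\<lambda>B. emeasure M B \<le> ennreal p * emeasure lborel B"] lo P(1) by blast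
    \<comment> \<open>The second covering must take place inside an open set. Passing to open balls
      discards only countably many spheres, which are null.\<close>
    define V where "V = (\<Union>i\<in>C. ball (fst i) (snd i))"
    have "open V" unfolding V_def by auto
    have negV: "negligible (P - V)"
    proof (rule negligible_subset)
      show "negligible ((P - (\<Union>i\<in>C. ?B i)) \<union> (\<Union>i\<in>C. sphere (fst i) (snd i)))"
        using negC C(1) by (intro negligible_Un negligible_countable_Union) (auto intro: negligible_sphere)
      show "P - V \<subseteq> (P - (\<Union>i\<in>C. ?B i)) \<union> (\<Union>i\<in>C. sphere (fst i) (snd i))"
        unfolding V_def by force
    qed
    obtain J where J: "countable J" "J \<subseteq> {i. 0 < snd i \<and> ?B i \<subseteq> V \<and> emeasure M (?B i) \<ge> ennreal q * emeasure lborel (?B i)}"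
      and pwJ: "pairwise (\<lambda>i j. disjnt (?B i) (?B j)) J" and negJ: "negligible (P \<inter> V - (\<Union>i\<in>J. ?B i))"
      using cover[OF \<open>open V\<close>, of "P \<inter> V" "\<lambda>B. emeasure M B \<ge> ennreal q * emeasure lborel B"] hi P(1) by blast
    define W where "W = (\<Union>i\<in>J. ?B i)"
    have Wb: "W \<in> sets borel"
      unfolding W_def using J(1) by (intro sets.countable_UN') auto
    have Cb: "(\<Union>i\<in>C. ?B i) \<in> sets borel"
      using C(1) by (intro sets.countable_UN') auto
    \<comment> \<open>Disjointness turns the density bounds on single balls into bounds on unions:
      \<open>q\<close> times the volume of \<open>W\<close> is at most the \<open>M\<close>-mass of
      \<open>W\<close>, hence at most that of the first family, hence at most \<open>p\<close> times
      the volume of \<open>U\<close>.\<close>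
    have "ennreal q * emeasure lborel W = (\<integral>\<^sup>+i. ennreal q * emeasure lborel (?B i) \<partial>count_space J)"
      unfolding W_def using emeasure_disjoint_cballs[OF _ J(1) pwJ, of lborel] by (simp add: nn_integral_cmult)
    also have "\<dots> \<le> (\<integral>\<^sup>+i. emeasure M (?B i) \<partial>count_space J)"
      using J(2) by (intro nn_integral_mono) auto
    also have "\<dots> = emeasure M W"
      unfolding W_def using emeasure_disjoint_cballs[OF M J(1) pwJ] by simp
    also have "\<dots> \<le> emeasure M (\<Union>i\<in>C. ?B i)"
    proof (intro emeasure_mono)
      show "W \<subseteq> (\<Union>i\<in>C. ?B i)"
        unfolding W_def using J(2) by (force simp: V_def)
    qed (use Cb M in auto)
    also have "\<dots> = (\<integral>\<^sup>+i. emeasure M (?B i) \<partial>count_space C)"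
      using emeasure_disjoint_cballs[OF M C(1) pwC] by simp
    also have "\<dots> \<le> (\<integral>\<^sup>+i. ennreal p * emeasure lborel (?B i) \<partial>count_space C)"
      using C(2) by (intro nn_integral_mono) auto
    also have "\<dots> = ennreal p * emeasure lborel (\<Union>i\<in>C. ?B i)"
      using emeasure_disjoint_cballs[OF _ C(1) pwC, of lborel] by (simp add: nn_integral_cmult)
    also have "\<dots> \<le> ennreal p * emeasure lborel U"
      using C(2) U(1) by (intro mult_left_mono emeasure_mono) auto
    finally have le: "ennreal q * emeasure lborel W \<le> ennreal p * emeasure lborel U" .
    have Um: "emeasure lborel U = ennreal (?\<mu> U)"
      using U emeasure_eq_measure2[OF U(2)] by simp
    have "W \<subseteq> U"
      unfolding W_def V_def using J(2) C(2) by (force simp: V_def)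
    then have Wl: "W \<in> lmeasurable"
      using Wb U(2) by (intro fmeasurableI2[OF U(2)]) auto
    have Wm: "emeasure lborel W = ennreal (?\<mu> W)"
      using Wb emeasure_eq_measure2[OF Wl] by simp
    have "q * ?\<mu> W \<le> p * ?\<mu> U"
      using le pq unfolding Um Wm by (simp flip: ennreal_mult)
    then have W_le: "?\<mu> W \<le> p / q * ?\<mu> U"
      using pq by (simp add: field_simps)
    define N where "N = (P - V) \<union> (P \<inter> V - W)"
    have N: "negligible N"
      unfolding N_def W_def using negV negJ by (rule negligible_Un)
    have "?\<mu> (W \<union> N) = ?\<mu> W"
      using fmeasurableD[OF Wl] N[unfolded negligible_iff_null_sets] by (rule measure_Un_null_set)
    moreover have "W \<union> N \<in> lmeasurable"
      by (intro fmeasurable.Un Wl negligible_imp_measurable[OF N])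
    moreover have "P \<subseteq> W \<union> N"
      unfolding N_def by auto
    ultimately show "\<exists>T. T \<in> lmeasurable \<and> P \<subseteq> T \<and> ?\<mu> T \<le> p / q * ?\<mu> U"
      using W_le by auto
  qed
qed

text \<open>The bounds keep the lower and upper limits finite, so failure of convergence means that
  they differ, and two rationals fit strictly between them. Rationality makes the exceptional sets a
  countable family.\<close>

lemma not_tendsto_imp_oscillates:
  fixes g :: "'a \<Rightarrow> real"
  assumes "F \<noteq> bot" and lo: "\<And>x. l \<le> g x" and hi: "\<And>x. g x \<le> u" and "\<nexists>L. (g \<longlongrightarrow> L) F"
  shows "\<exists>p q. p \<in> \<rat> \<and> q \<in> \<rat> \<and> p < q \<and> (\<exists>\<^sub>F x in F. g x < p) \<and> (\<exists>\<^sub>F x in F. q < g x)"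
proof (rule ccontr)
  assume no: "\<not> ?thesis"
  define a where "a = Liminf F (\<lambda>x. ereal (g x))"
  define b where "b = Limsup F (\<lambda>x. ereal (g x))"
  have "a \<le> b"
    unfolding a_def b_def by (rule Liminf_le_Limsup[OF \<open>F \<noteq> bot\<close>])
  have "ereal l \<le> a"
    unfolding a_def using lo by (intro Liminf_bounded) auto
  have "b \<le> ereal u"
    unfolding b_def using hi by (intro Limsup_bounded) auto
  have "\<not> a < b"
  proof
    assume "a < b"
    then obtain p where p: "p \<in> \<rat>" "a < ereal p" "ereal p < b"
      by (metis Rats_of_rat ereal_dense3)
    then obtain q where q: "q \<in> \<rat>" "ereal p < ereal q" "ereal q < b"
      by (metis Rats_of_rat ereal_dense3)
    have "\<exists>\<^sub>F x in F. g x < p"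
    proof (rule ccontr)
      assume "\<not> ?thesis"
      then have "\<forall>\<^sub>F x in F. ereal p \<le> ereal (g x)"
        by (simp add: frequently_def not_less)
      then have "ereal p \<le> a"
        unfolding a_def by (rule Liminf_bounded)
      with p show False by auto
    qed
    moreover have "\<exists>\<^sub>F x in F. q < g x"
    proof (rule ccontr)
      assume "\<not> ?thesis"
      then have "\<forall>\<^sub>F x in F. ereal (g x) \<le> ereal q"
        by (simp add: frequently_def not_less)
      then have "b \<le> ereal q"
        unfolding b_def by (rule Limsup_bounded)
      with q show False by auto
    qed
    ultimately show False
      using no p(1) q by auto
  qed
  with \<open>a \<le> b\<close> have "a = b" by auto
  with \<open>ereal l \<le> a\<close> \<open>b \<le> ereal u\<close> obtain L where L: "a = ereal L" "b = ereal L"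
    by (cases a) auto
  have "((\<lambda>x. ereal (g x)) \<longlongrightarrow> ereal L) F"
    using L unfolding a_def b_def by (intro Liminf_eq_Limsup \<open>F \<noteq> bot\<close>) auto
  then have "(g \<longlongrightarrow> L) F" by simp
  with assms(4) show False by blast
qed

text \<open>The difference quotient between \<open>x\<close> and \<open>y\<close> is the mean
  density of the Stieltjes measure of \<open>F\<close> on the interval with these endpoints. A point
  of nondifferentiability therefore has a density gap between two rationals
  \<open>p < q\<close>.\<close>

lemma negligible_nondifferentiable_mono_lipschitz:
  fixes F :: "real \<Rightarrow> real"
  assumes "mono F" and lip: "L-lipschitz_on UNIV F"
  shows "negligible {x. \<not> F differentiable at x}"
proof -
  let ?Q = "\<lambda>x y. (F y - F x) / (y - x)"
  have cont: "continuous_on UNIV F"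
    using lip by (rule lipschitz_on_continuous_on)
  have Q: "0 \<le> ?Q x y" "?Q x y \<le> L" for x y
  proof -
    show "0 \<le> ?Q x y"
      using monoD[OF \<open>mono F\<close>, of x y] monoD[OF \<open>mono F\<close>, of y x]
      by (cases "x \<le> y") (auto simp: zero_le_divide_iff)
    have "\<bar>?Q x y\<bar> \<le> L"
      using lipschitz_onD[OF lip, of y x] lipschitz_on_nonneg[OF lip]
      by (cases "x = y") (auto simp: dist_real_def abs_divide divide_le_eq)
    then show "?Q x y \<le> L" by (rule order_trans[OF abs_ge_self])
  qed
  have sym: "?Q x y = ?Q y x" for x y
    by (metis minus_diff_eq minus_divide_divide)
  define M where "M = interval_measure F"
  \<comment> \<open>The closed ball about the midpoint is the interval between \<open>x\<close> and
    \<open>y\<close>; the absolute value covers both orders of the endpoints.\<close>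
  have M: "emeasure M (cball ((x+y)/2) \<bar>(x-y)/2\<bar>) = ennreal (?Q x y) * emeasure lborel (cball ((x+y)/2) \<bar>(x-y)/2\<bar>)"
    if "x \<noteq> y" for x y
  proof -
    have *: "emeasure M (cball ((x+y)/2) \<bar>(x-y)/2\<bar>) = ennreal (?Q x y) * emeasure lborel (cball ((x+y)/2) \<bar>(x-y)/2\<bar>)"
      if "x < y" for x y
    proof -
      have ball: "cball ((x+y)/2) \<bar>(x-y)/2\<bar> = {x..y}"
        using that by (auto simp: cball_eq_atLeastAtMost abs_if field_simps)
      have "emeasure M {x..y} = ennreal (F y - F x)"
        unfolding M_def using that monoD[OF \<open>mono F\<close>] cont by (intro emeasure_interval_measure_Icc) auto
      also have "F y - F x = ?Q x y * (y - x)"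
        using that by simp
      also have "ennreal \<dots> = ennreal (?Q x y) * ennreal (y - x)"
        using Q that by (intro ennreal_mult) auto
      finally show ?thesis
        unfolding ball using that by simp
    qed
    show ?thesis
    proof (cases "x < y")
      case False
      then have "y < x" using that by auto
      from *[OF this] show ?thesis
        by (simp add: sym[of y x] add.commute abs_minus_commute)
    qed (rule *)
  qed
  define S where "S p q = {x. (\<exists>\<^sub>F y in at x. ?Q x y < p) \<and> (\<exists>\<^sub>F y in at x. q < ?Q x y)}" for p q
  have interval: "\<exists>z r. 0 < r \<and> r < d \<and> x \<in> cball z r \<and> (\<exists>y. R (?Q x y) \<and>
        emeasure M (cball z r) = ennreal (?Q x y) * emeasure lborel (cball z r))"
    if freq: "\<exists>\<^sub>F y in at x. R (?Q x y)" and d: "0 < d" for R x d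
  proof -
    obtain y where y: "y \<noteq> x" "dist y x < d" "R (?Q x y)"
      using freq d unfolding frequently_at by blast
    have "x \<in> cball ((x+y)/2) \<bar>(x-y)/2\<bar>"
      by (auto simp: dist_real_def abs_if field_simps)
    moreover have "0 < \<bar>(x-y)/2\<bar>" "\<bar>(x-y)/2\<bar> < d"
      using y by (auto simp: dist_real_def abs_if field_simps split: if_splits)
    ultimately show ?thesis
      using M[of x y] y by blast
  qed
  have negS: "negligible (S p q)" if "0 < p" "p < q" for p q
  proof (rule negligible_of_density_gap[OF _ that, of M])
    show "sets M = sets borel" by (simp add: M_def)
  next
    fix x d :: real assume xd: "x \<in> S p q" "0 < d"
    obtain z r y where "0 < r" "r < d" "x \<in> cball z r" and y: "?Q x y < p"
        "emeasure M (cball z r) = ennreal (?Q x y) * emeasure lborel (cball z r)"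
      using interval[of "\<lambda>t. t < p" x d] xd by (auto simp: S_def)
    moreover have "emeasure M (cball z r) \<le> ennreal p * emeasure lborel (cball z r)"
      unfolding y(2) using y(1) by (intro mult_right_mono ennreal_leI) auto
    ultimately show "\<exists>z r. 0 < r \<and> r < d \<and> x \<in> cball z r \<and> emeasure M (cball z r) \<le> ennreal p * emeasure lborel (cball z r)"
      by blast
  next
    fix x d :: real assume xd: "x \<in> S p q" "0 < d"
    obtain z r y where "0 < r" "r < d" "x \<in> cball z r" and y: "q < ?Q x y"
        "emeasure M (cball z r) = ennreal (?Q x y) * emeasure lborel (cball z r)"
      using interval[of "\<lambda>t. q < t" x d] xd by (auto simp: S_def)
    moreover have "emeasure M (cball z r) \<ge> ennreal q * emeasure lborel (cball z r)"
      unfolding y(2) using y(1) by (intro mult_right_mono ennreal_leI) auto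
    ultimately show "\<exists>z r. 0 < r \<and> r < d \<and> x \<in> cball z r \<and> emeasure M (cball z r) \<ge> ennreal q * emeasure lborel (cball z r)"
      by blast
  qed
  have "negligible (\<Union>(p,q)\<in>{(p,q). p \<in> \<rat> \<and> q \<in> \<rat> \<and> 0 < p \<and> p < q}. S p q)"
    using negS countable_subset[of "{(p,q). p \<in> \<rat> \<and> q \<in> \<rat> \<and> 0 < p \<and> p < q}" "(\<rat>::real set) \<times> (\<rat>::real set)"]
    by (intro negligible_countable_Union countable_image) (auto intro: countable_rat)
  moreover have "{x. \<not> F differentiable at x} \<subseteq> (\<Union>(p,q)\<in>{(p,q). p \<in> \<rat> \<and> q \<in> \<rat> \<and> 0 < p \<and> p < q}. S p q)"
  proof
    fix x assume "x \<in> {x. \<not> F differentiable at x}"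
    then have "\<nexists>D. ((\<lambda>y. ?Q x y) \<longlongrightarrow> D) (at x)"
      by (auto simp: real_differentiable_def has_field_derivative_iff)
    then obtain p q where pq: "p \<in> \<rat>" "q \<in> \<rat>" "p < q" "\<exists>\<^sub>F y in at x. ?Q x y < p" "\<exists>\<^sub>F y in at x. q < ?Q x y"
      using not_tendsto_imp_oscillates[of "at x" 0 "?Q x" L] Q by auto
    obtain y where "?Q x y < p"
      using pq(4) frequently_ex by blast
    \<comment> \<open>The quotients of a monotone function are nonnegative, so one of them lying
      below \<open>p\<close> supplies the positivity that the density gap lemma requires.\<close>
    then have "0 < p"
      by (rule le_less_trans[OF Q(1)])
    with pq show "x \<in> (\<Union>(p,q)\<in>{(p,q). p \<in> \<rat> \<and> q \<in> \<rat> \<and> 0 < p \<and> p < q}. S p q)"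
      by (auto simp: S_def)
  qed
  ultimately show ?thesis by (rule negligible_subset)
qed

text \<open>Adding \<open>L * x\<close> makes \<open>f\<close> monotone and does not change where it
  is differentiable.\<close>

lemma negligible_nondifferentiable_lipschitz_real:
  fixes f :: "real \<Rightarrow> real"
  assumes lip: "L-lipschitz_on UNIV f"
  shows "negligible {x. \<not> f differentiable at x}"
proof -
  let ?F = "\<lambda>x. f x + L * x"
  have "L \<ge> 0" using lip by (rule lipschitz_on_nonneg)
  have "mono ?F"
  proof
    fix x y :: real assume "x \<le> y"
    then show "?F x \<le> ?F y"
      using lipschitz_onD[OF lip, of x y] by (auto simp: dist_real_def abs_if algebra_simps split: if_splits)
  qed
  moreover have "(L + L)-lipschitz_on UNIV ?F"
  proof (rule lipschitz_onI)
    fix x y :: real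
    have "dist (?F x) (?F y) \<le> dist (f x) (f y) + dist (L * x) (L * y)"
      by (rule dist_triangle_add)
    also have "\<dots> \<le> L * dist x y + L * dist x y"
      using lipschitz_onD[OF lip, of x y] \<open>L \<ge> 0\<close>
      by (intro add_mono) (auto simp: dist_real_def abs_mult simp flip: right_diff_distrib)
    finally show "dist (?F x) (?F y) \<le> (L + L) * dist x y" by (simp add: algebra_simps)
  qed (use \<open>L \<ge> 0\<close> in auto)
  ultimately have "negligible {x. \<not> ?F differentiable at x}"
    by (rule negligible_nondifferentiable_mono_lipschitz)
  moreover have "f differentiable at x" if "?F differentiable at x" for x
  proof -
    have "(\<lambda>x. L * x) differentiable at x"
      by (intro derivative_intros)
    from differentiable_diff[OF that this] show ?thesis by simp
  qed
  ultimately show ?thesis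
    by (elim negligible_subset) auto
qed

section \<open>Rademacher's theorem for real functions of several variables\<close>

text \<open>Averaging over the translates \<open>N - t *\<^sub>R v\<close>, \<open>0 \<le> t \<le> 1\<close>, which all have the measure of \<open>N\<close>,
  reduces this to Fubini's theorem without choosing coordinates adapted to \<open>v\<close>.\<close>
lemma null_sets_if_null_on_lines:
  fixes N :: "'a::euclidean_space set"
  assumes N [measurable]: "N \<in> sets borel" and lines: "\<And>x. negligible {t::real. x + t *\<^sub>R v \<in> N}"
  shows "N \<in> null_sets lborel"
proof -
  have [measurable]: "{t::real. x + t *\<^sub>R v \<in> N} \<in> sets borel" for x
    by measurable
  have "emeasure lborel N = (\<integral>\<^sup>+t. indicator {0..1} t * emeasure lborel N \<partial>(lborel :: real measure))"
    by (subst nn_integral_multc) auto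
  also have "\<dots> = (\<integral>\<^sup>+t. (\<integral>\<^sup>+x. indicator {0..1} t * indicator N (x + t *\<^sub>R v) \<partial>lborel) \<partial>(lborel :: real measure))"
  proof (rule nn_integral_cong)
    fix t :: real
    have "emeasure lborel N = (\<integral>\<^sup>+x. indicator N x \<partial>distr lborel borel ((+) (t *\<^sub>R v)))"
      by (simp add: lborel_distr_plus)
    also have "\<dots> = (\<integral>\<^sup>+x. indicator N (x + t *\<^sub>R v) \<partial>lborel)"
      by (subst nn_integral_distr) (auto simp: add.commute)
    finally show "indicator {0..1} t * emeasure lborel N = (\<integral>\<^sup>+x. indicator {0..1} t * indicator N (x + t *\<^sub>R v) \<partial>lborel)"
      by (simp add: nn_integral_cmult)
  qed
  also have "\<dots> = (\<integral>\<^sup>+x. (\<integral>\<^sup>+t. indicator {0..1} t * indicator N (x + t *\<^sub>R v) \<partial>(lborel :: real measure)) \<partial>lborel)"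
    by (rule lborel_pair.Fubini') measurable
  also have "\<dots> = (\<integral>\<^sup>+x. 0 \<partial>(lborel :: 'a measure))"
  proof (rule nn_integral_cong)
    fix x :: 'a
    have "{t. x + t *\<^sub>R v \<in> N} \<in> null_sets (lborel :: real measure)"
      using lines[of x] null_sets_completion_iff[of "{t. x + t *\<^sub>R v \<in> N}" lborel]
      by (simp add: negligible_iff_null_sets)
    then have "AE t in lborel. t \<notin> {t. x + t *\<^sub>R v \<in> N}"
      by (rule AE_not_in)
    then have "(\<integral>\<^sup>+t. indicator {0..1} t * indicator N (x + t *\<^sub>R v) \<partial>lborel) = (\<integral>\<^sup>+t. 0 \<partial>(lborel :: real measure))"
      by (intro nn_integral_cong_AE) (auto elim: eventually_mono)
    then show "(\<integral>\<^sup>+t. indicator {0..1} t * indicator N (x + t *\<^sub>R v) \<partial>(lborel :: real measure)) = 0" by simp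
  qed
  finally show ?thesis by (intro null_setsI) auto
qed

text \<open>Restricted to a line parallel to \<open>v\<close>, \<open>f\<close> is Lipschitz in one
  variable, so the exceptional set is null on each line. Fubini needs a Borel set; for this the
  existence of the limit is expressed by a Cauchy criterion.\<close>

lemma negligible_no_directional_derivative:
  fixes f :: "'a::euclidean_space \<Rightarrow> real"
  assumes lip: "L-lipschitz_on UNIV f"
  shows "negligible {x. \<nexists>l. ((\<lambda>t. (f (x + t *\<^sub>R v) - f x) / t) \<longlongrightarrow> l) (at 0)}"
proof -
  let ?Q = "\<lambda>x t. (f (x + t *\<^sub>R v) - f x) / t"
  have cont: "continuous_on UNIV f"
    using lip by (rule lipschitz_on_continuous_on)
  \<comment> \<open>For fixed \<open>s\<close> and \<open>t\<close> the condition is closed in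
    \<open>x\<close>, by continuity of \<open>f\<close>; hence \<open>A k m\<close> is closed, and
    countable unions and intersections make \<open>N\<close> Borel.\<close>
  define A where "A k m = {x. \<forall>s t. 0 < \<bar>s\<bar> \<and> \<bar>s\<bar> < inverse (real (Suc m)) \<and> 0 < \<bar>t\<bar> \<and> \<bar>t\<bar> < inverse (real (Suc m)) \<longrightarrow>
    \<bar>?Q x s - ?Q x t\<bar> \<le> inverse (real (Suc k))}" for k m
  have "continuous_on UNIV (\<lambda>x. ?Q x t)" for t
    unfolding divide_inverse by (intro continuous_intros continuous_on_compose2[OF cont]) auto
  then have "closed (A k m)" for k m
    unfolding A_def
    by (intro closed_Collect_all closed_Collect_imp open_Collect_const closed_Collect_le
        continuous_on_rabs continuous_on_diff continuous_on_const)
  define N where "N = - (\<Inter>k. \<Union>m. A k m)"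
  have "N \<in> sets borel"
    unfolding N_def using \<open>\<And>k m. closed (A k m)\<close> by (intro borel_comp sets.countable_INT' sets.countable_UN') auto
  have "negligible {t::real. x + t *\<^sub>R v \<in> N}" for x
  proof -
    define \<phi> where "\<phi> t = f (x + t *\<^sub>R v)" for t
    have "(L * norm v)-lipschitz_on UNIV \<phi>"
    proof (rule lipschitz_onI)
      fix s t :: real
      have "dist (\<phi> s) (\<phi> t) \<le> L * dist (x + s *\<^sub>R v) (x + t *\<^sub>R v)"
        unfolding \<phi>_def using lipschitz_onD[OF lip] by blast
      also have "dist (x + s *\<^sub>R v) (x + t *\<^sub>R v) = norm v * dist s t"
        by (simp add: dist_norm flip: scaleR_left_diff_distrib)
      finally show "dist (\<phi> s) (\<phi> t) \<le> L * norm v * dist s t" by (simp add: mult.assoc)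
    qed (use lipschitz_on_nonneg[OF lip] in auto)
    then have "negligible {t. \<not> \<phi> differentiable at t}"
      by (rule negligible_nondifferentiable_lipschitz_real)
    moreover have "x + t *\<^sub>R v \<notin> N" if "\<phi> differentiable at t" for t
    proof -
      obtain D where "((\<lambda>h. (\<phi> (t + h) - \<phi> t) / h) \<longlongrightarrow> D) (at 0)"
        using \<open>\<phi> differentiable at t\<close> by (auto simp: real_differentiable_def DERIV_def)
      then have lim: "(?Q (x + t *\<^sub>R v) \<longlongrightarrow> D) (at 0)"
        by (simp add: \<phi>_def algebra_simps)
      have "\<exists>m. x + t *\<^sub>R v \<in> A k m" for k
      proof -
        define e where "e = inverse (real (Suc k))"
        have "e > 0" unfolding e_def by simp
        then have "\<forall>\<^sub>F s in at 0. dist (?Q (x + t *\<^sub>R v) s) D < e / 2"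
          using tendstoD[OF lim, of "e/2"] by simp
        then obtain d where d: "d > 0" "\<And>s. s \<noteq> 0 \<Longrightarrow> \<bar>s\<bar> < d \<Longrightarrow> dist (?Q (x + t *\<^sub>R v) s) D < e / 2"
          unfolding eventually_at by (auto simp: dist_real_def)
        obtain m where m: "inverse (real (Suc m)) < d"
          using \<open>d > 0\<close> reals_Archimedean by blast
        have "x + t *\<^sub>R v \<in> A k m"
          unfolding A_def mem_Collect_eq
        proof (intro allI impI, elim conjE)
          fix s s' assume "0 < \<bar>s\<bar>" "\<bar>s\<bar> < inverse (real (Suc m))" "0 < \<bar>s'\<bar>" "\<bar>s'\<bar> < inverse (real (Suc m))"
          then have "dist (?Q (x + t *\<^sub>R v) s) D < e / 2" "dist (?Q (x + t *\<^sub>R v) s') D < e / 2"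
            using d(2)[of s] d(2)[of s'] m by auto
          then have "dist (?Q (x + t *\<^sub>R v) s) (?Q (x + t *\<^sub>R v) s') < e"
            by (rule dist_triangle_half_l)
          then show "\<bar>?Q (x + t *\<^sub>R v) s - ?Q (x + t *\<^sub>R v) s'\<bar> \<le> inverse (real (Suc k))"
            by (simp add: dist_real_def e_def)
        qed
        then show ?thesis ..
      qed
      then show ?thesis unfolding N_def by blast
    qed
    ultimately show ?thesis by (elim negligible_subset) auto
  qed
  with \<open>N \<in> sets borel\<close> have "N \<in> null_sets lborel"
    by (rule null_sets_if_null_on_lines)
  then have "negligible N"
    by (simp add: negligible_iff_null_sets null_sets_completionI)
  moreover have "\<exists>l. (?Q x \<longlongrightarrow> l) (at 0)" if "x \<notin> N" for x
  proof -
    have "\<exists>P. eventually P (at 0) \<and> (\<forall>s t. P s \<and> P t \<longrightarrow> dist (?Q x s) (?Q x t) < e)" if "e > 0" for e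
    proof -
      obtain k where k: "inverse (real (Suc k)) < e"
        using \<open>e > 0\<close> reals_Archimedean by blast
      obtain m where m: "x \<in> A k m"
        using \<open>x \<notin> N\<close> unfolding N_def by blast
      have "eventually (\<lambda>t. 0 < \<bar>t\<bar> \<and> \<bar>t\<bar> < inverse (real (Suc m))) (at (0::real))"
        unfolding eventually_at by (intro exI[of _ "inverse (real (Suc m))"]) auto
      moreover have "dist (?Q x s) (?Q x t) < e"
        if "0 < \<bar>s\<bar> \<and> \<bar>s\<bar> < inverse (real (Suc m))" "0 < \<bar>t\<bar> \<and> \<bar>t\<bar> < inverse (real (Suc m))" for s t
        using m k that unfolding A_def dist_real_def by fastforce
      ultimately show ?thesis by blast
    qed
    then have "cauchy_filter (filtermap (?Q x) (at 0))"
      unfolding cauchy_filter_metric_filtermap by blast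
    then show ?thesis
      using cauchy_filter_complete_converges[of "filtermap (?Q x) (at 0)" UNIV]
      by (auto simp: filterlim_def complete_UNIV filtermap_bot_iff)
  qed
  ultimately show ?thesis
    by (elim negligible_subset) auto
qed

text \<open>Move from \<open>x\<close> to \<open>x + h\<close> along one coordinate at a time. Before each move, jump to a nearby
  point of \<open>E\<close>, where the increment in the coordinate direction is controlled; nonporosity makes the jump short.\<close>
lemma increment_bound_nonporous:
  fixes f :: "'a::euclidean_space \<Rightarrow> real"
  assumes lip: "L-lipschitz_on UNIV f" and np: "nonporous_at E x" and "e > 0" "d > 0"
    and E: "\<And>z b t. z \<in> E \<Longrightarrow> b \<in> Basis \<Longrightarrow> \<bar>t\<bar> < d \<Longrightarrow> \<bar>f (z + t *\<^sub>R b) - f z - t * (q \<bullet> b)\<bar> \<le> e * \<bar>t\<bar>"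
    and "finite A" "A \<subseteq> Basis"
  shows "\<exists>\<delta>>0. \<forall>h. norm h < \<delta> \<longrightarrow> (let h' = (\<Sum>b\<in>A. (h \<bullet> b) *\<^sub>R b) in
    \<bar>f (x + h') - f x - q \<bullet> h'\<bar> \<le> 2 * e * card A * norm h)"
  using \<open>finite A\<close> \<open>A \<subseteq> Basis\<close>
proof (induction A rule: finite_induct)
  case empty
  show ?case by (intro exI[of _ 1]) simp
next
  case (insert b A)
  have "L \<ge> 0" using lip by (rule lipschitz_on_nonneg)
  obtain \<delta> where \<delta>: "\<delta> > 0" "\<And>h. norm h < \<delta> \<Longrightarrow>
      \<bar>f (x + (\<Sum>b\<in>A. (h \<bullet> b) *\<^sub>R b)) - f x - q \<bullet> (\<Sum>b\<in>A. (h \<bullet> b) *\<^sub>R b)\<bar> \<le> 2 * e * card A * norm h"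
    using insert by (auto simp: Let_def)
  \<comment> \<open>The jump from \<open>x + h'\<close> to \<open>z\<close> costs
    \<open>L * \<epsilon> * norm h\<close> at each end of the move. The two costs together are at
    most \<open>e * norm h\<close>; a further \<open>e * norm h\<close> comes from the increment at
    \<open>z\<close>, hence \<open>2 * e\<close> per coordinate.\<close>
  define \<epsilon> where "\<epsilon> = e / (2 * L + 1)"
  have "\<epsilon> > 0" "2 * L * \<epsilon> \<le> e"
    using \<open>e > 0\<close> \<open>L \<ge> 0\<close> by (auto simp: \<epsilon>_def field_simps)
  obtain \<rho> where \<rho>: "\<rho> > 0" "\<And>y. dist y x < \<rho> \<Longrightarrow> \<exists>z\<in>E. dist z y \<le> \<epsilon> * dist y x"
    using np \<open>\<epsilon> > 0\<close> unfolding nonporous_at_def by blast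
  show ?case
  proof (intro exI[of _ "min \<delta> (min \<rho> d)"] conjI allI impI)
    show "0 < min \<delta> (min \<rho> d)" using \<delta> \<rho> \<open>d > 0\<close> by auto
    fix h :: 'a assume h: "norm h < min \<delta> (min \<rho> d)"
    define h' where "h' = (\<Sum>b\<in>A. (h \<bullet> b) *\<^sub>R b)"
    \<comment> \<open>Dropping coordinates does not increase the norm, so \<open>x + h'\<close>
      stays in the range where nonporosity applies.\<close>
    have "norm h' \<le> norm h"
    proof (rule norm_le_componentwise)
      fix c :: 'a assume "c \<in> Basis"
      have "h' \<bullet> c = (\<Sum>b\<in>A. if b = c then h \<bullet> b else 0)"
        unfolding h'_def inner_sum_left using insert.prems \<open>c \<in> Basis\<close>
        by (intro sum.cong) (auto simp: inner_Basis)
      then show "\<bar>h' \<bullet> c\<bar> \<le> \<bar>h \<bullet> c\<bar>"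
        using insert.hyps by simp
    qed
    define t where "t = h \<bullet> b"
    have b: "b \<in> Basis" using insert.prems by auto
    have t: "\<bar>t\<bar> \<le> norm h"
      unfolding t_def using b by (rule Basis_le_norm)
    obtain z where z: "z \<in> E" "dist z (x + h') \<le> \<epsilon> * dist (x + h') x"
      using \<rho>(2)[of "x + h'"] \<open>norm h' \<le> norm h\<close> h by (auto simp: dist_norm)
    have zh: "dist z (x + h') \<le> \<epsilon> * norm h"
      using z(2) \<open>norm h' \<le> norm h\<close> \<open>\<epsilon> > 0\<close> by (simp add: dist_norm mult_left_mono order_trans)
    have "L * dist z (x + h') \<le> L * (\<epsilon> * norm h)"
      using zh \<open>L \<ge> 0\<close> by (rule mult_left_mono)
    then have "\<bar>f z - f (x + h')\<bar> \<le> L * \<epsilon> * norm h" "\<bar>f (z + t *\<^sub>R b) - f (x + h' + t *\<^sub>R b)\<bar> \<le> L * \<epsilon> * norm h"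
      using lipschitz_onD[OF lip, of z "x + h'"] lipschitz_onD[OF lip, of "z + t *\<^sub>R b" "x + h' + t *\<^sub>R b"]
      by (auto simp: dist_real_def mult.assoc dist_add_cancel2)
    moreover have "\<bar>f (z + t *\<^sub>R b) - f z - t * (q \<bullet> b)\<bar> \<le> e * norm h"
      using E[OF z(1) b, of t] t h mult_left_mono[OF t, of e] \<open>e > 0\<close> by linarith
    moreover have "2 * (L * \<epsilon> * norm h) \<le> e * norm h"
      using mult_right_mono[OF \<open>2 * L * \<epsilon> \<le> e\<close>, of "norm h"] by (simp add: mult.assoc)
    moreover have "\<bar>f (x + h') - f x - q \<bullet> h'\<bar> \<le> 2 * e * card A * norm h"
      unfolding h'_def using \<delta>(2) h by auto
    ultimately have "\<bar>f (x + h' + t *\<^sub>R b) - f x - (q \<bullet> h' + t * (q \<bullet> b))\<bar> \<le> 2 * e * card A * norm h + 2 * (e * norm h)"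
      by linarith
    also have "\<dots> = 2 * e * card (insert b A) * norm h"
      using insert.hyps by (simp add: algebra_simps)
    finally show "let h' = (\<Sum>b\<in>insert b A. (h \<bullet> b) *\<^sub>R b) in
        \<bar>f (x + h') - f x - q \<bullet> h'\<bar> \<le> 2 * e * card (insert b A) * norm h"
      using insert.hyps by (simp add: Let_def h'_def[symmetric] t_def inner_add_right algebra_simps)
  qed
qed

text \<open>The sets \<open>E k m q\<close>, with \<open>q\<close> from a countable dense set,
  collect the points whose partial difference quotients are within
  \<open>inverse (real (Suc k))\<close> of the components of \<open>q\<close> at all scales below
  \<open>inverse (real (Suc m))\<close>. Off a null set all partial derivatives exist and
  \<open>x\<close> is nonporous in each such set containing it, so the coordinate walk shows that
  the vector of partial derivatives is the gradient.\<close>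

theorem Rademacher_real:
  fixes f :: "'a::euclidean_space \<Rightarrow> real"
  assumes lip: "L-lipschitz_on UNIV f"
  shows "negligible {x. \<not> f differentiable at x}"
proof -
  let ?Q = "\<lambda>x b t. (f (x + t *\<^sub>R b) - f x) / t"
  obtain D :: "'a set" where D: "countable D" "\<And>X. open X \<Longrightarrow> X \<noteq> {} \<Longrightarrow> \<exists>d\<in>D. d \<in> X"
    using countable_dense_exists by blast
  define E where "E k m q = {z. \<forall>b\<in>Basis. \<forall>t. \<bar>t\<bar> < inverse (real (Suc m)) \<longrightarrow>
    \<bar>f (z + t *\<^sub>R b) - f z - t * (q \<bullet> b)\<bar> \<le> inverse (real (Suc k)) * \<bar>t\<bar>}" for k m q
  define N1 where "N1 = (\<Union>b\<in>Basis. {x. \<nexists>l. (?Q x b \<longlongrightarrow> l) (at 0)})"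
  define N2 where "N2 = (\<Union>q\<in>D. \<Union>k. \<Union>m. {x\<in>E k m q. \<not> nonporous_at (E k m q) x})"
  have "negligible N1"
    unfolding N1_def using negligible_no_directional_derivative[OF lip] by auto
  moreover have "negligible N2"
    unfolding N2_def using negligible_porous_points D(1) by (intro negligible_countable_Union countable_image) auto
  ultimately have "negligible (N1 \<union> N2)" by (rule negligible_Un)
  moreover have "f differentiable at x" if x: "x \<notin> N1 \<union> N2" for x
  proof -
    obtain g where g: "\<And>b. b \<in> Basis \<Longrightarrow> (?Q x b \<longlongrightarrow> g b) (at 0)"
    proof -
      have "\<forall>b\<in>Basis. \<exists>l. (?Q x b \<longlongrightarrow> l) (at 0)"
        using x unfolding N1_def by blast
      then show ?thesis using that by metis
    qed
    define G where "G = (\<Sum>b\<in>Basis. g b *\<^sub>R b)"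
    have G: "G \<bullet> b = g b" if "b \<in> Basis" for b
      using that unfolding G_def by simp
    \<comment> \<open>The coordinate walk contributes \<open>2 * DIM('a)\<close> to the constant,
      and the replacement of \<open>q\<close> by \<open>G\<close> contributes
      \<open>1\<close>.\<close>
    have approx: "\<exists>\<delta>>0. \<forall>h. norm h < \<delta> \<longrightarrow> \<bar>f (x + h) - f x - G \<bullet> h\<bar> \<le> (2 * real DIM('a) + 1) * inverse (real (Suc k)) * norm h" for k
    proof -
      define e where "e = inverse (real (Suc k))"
      have "e > 0" unfolding e_def by simp
      \<comment> \<open>Half of the tolerance is spent on the distance from \<open>q\<close> to
        \<open>G\<close>, the other half on the convergence of the quotients to
        \<open>g\<close>.\<close>
      obtain q where q: "q \<in> D" "q \<in> ball G (e / 2)"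
        using D(2)[of "ball G (e/2)"] \<open>e > 0\<close> by auto
      have "\<forall>\<^sub>F t in at 0. \<forall>b\<in>Basis. dist (?Q x b t) (g b) < e / 2"
        using tendstoD[OF g half_gt_zero[OF \<open>e > 0\<close>]] by (intro eventually_ball_finite) auto
      then obtain d where d: "d > 0" "\<And>t b. b \<in> Basis \<Longrightarrow> t \<noteq> 0 \<Longrightarrow> \<bar>t\<bar> < d \<Longrightarrow> dist (?Q x b t) (g b) < e / 2"
        unfolding eventually_at by (auto simp: dist_real_def)
      obtain m where m: "inverse (real (Suc m)) < d"
        using \<open>d > 0\<close> reals_Archimedean by blast
      have "x \<in> E k m q"
        unfolding E_def mem_Collect_eq
      proof (intro ballI allI impI)
        fix b :: 'a and t :: real assume b: "b \<in> Basis" and t: "\<bar>t\<bar> < inverse (real (Suc m))"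
        show "\<bar>f (x + t *\<^sub>R b) - f x - t * (q \<bullet> b)\<bar> \<le> inverse (real (Suc k)) * \<bar>t\<bar>"
        proof (cases "t = 0")
          case False
          have "\<bar>g b - q \<bullet> b\<bar> < e / 2"
            using q(2) Basis_le_norm[OF b, of "G - q"] by (simp add: G[OF b] inner_diff_left dist_norm)
          moreover have "\<bar>?Q x b t - g b\<bar> < e / 2"
            using d(2)[OF b False] t m by (simp add: dist_real_def)
          ultimately have "\<bar>?Q x b t - q \<bullet> b\<bar> \<le> e" by linarith
          then have "\<bar>?Q x b t - q \<bullet> b\<bar> * \<bar>t\<bar> \<le> e * \<bar>t\<bar>"
            by (intro mult_right_mono) auto
          also have "\<bar>?Q x b t - q \<bullet> b\<bar> * \<bar>t\<bar> = \<bar>f (x + t *\<^sub>R b) - f x - t * (q \<bullet> b)\<bar>"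
            using False by (simp flip: abs_mult add: field_simps)
          finally show ?thesis unfolding e_def .
        qed simp
      qed
      then have np: "nonporous_at (E k m q) x"
        using \<open>x \<notin> N1 \<union> N2\<close> q(1) unfolding N2_def by blast
      have "\<exists>\<delta>>0. \<forall>h. norm h < \<delta> \<longrightarrow> (let h' = (\<Sum>b\<in>Basis. (h \<bullet> b) *\<^sub>R b) in
          \<bar>f (x + h') - f x - q \<bullet> h'\<bar> \<le> 2 * e * DIM('a) * norm h)"
        by (rule increment_bound_nonporous[OF lip np \<open>e > 0\<close>, of "inverse (real (Suc m))"])
          (auto simp: E_def e_def)
      then obtain \<delta> where \<delta>: "\<delta> > 0" "\<And>h. norm h < \<delta> \<Longrightarrow> \<bar>f (x + h) - f x - q \<bullet> h\<bar> \<le> 2 * e * DIM('a) * norm h"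
        by (auto simp: euclidean_representation)
      have "\<bar>f (x + h) - f x - G \<bullet> h\<bar> \<le> (2 * real DIM('a) + 1) * e * norm h" if "norm h < \<delta>" for h
      proof -
        have "\<bar>(q - G) \<bullet> h\<bar> \<le> norm (q - G) * norm h"
          by (rule Cauchy_Schwarz_ineq2)
        also have "\<dots> \<le> e * norm h"
          using q(2) \<open>e > 0\<close> by (intro mult_right_mono) (auto simp: dist_norm norm_minus_commute)
        finally show ?thesis
          using \<delta>(2)[OF that] by (auto simp: inner_diff_left algebra_simps)
      qed
      with \<delta>(1) show ?thesis unfolding e_def by blast
    qed
    have "(f has_derivative (\<bullet>) G) (at x)"
      unfolding has_derivative_at_alt
    proof (intro conjI allI impI)
      show "bounded_linear ((\<bullet>) G)" by (rule bounded_linear_inner_right)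
      fix e :: real assume "e > 0"
      let ?c = "2 * real DIM('a) + 1"
      have "?c > 0" by simp
      obtain k where k: "inverse (real (Suc k)) < e / ?c"
        using reals_Archimedean[of "e / ?c"] \<open>e > 0\<close> \<open>?c > 0\<close> by (meson divide_pos_pos)
      obtain \<delta> where \<delta>: "\<delta> > 0" "\<And>h. norm h < \<delta> \<Longrightarrow> \<bar>f (x + h) - f x - G \<bullet> h\<bar> \<le> ?c * inverse (real (Suc k)) * norm h"
        using approx[of k] by blast
      have ce: "?c * inverse (real (Suc k)) \<le> e"
        using k \<open>?c > 0\<close> by (simp add: field_simps)
      show "\<exists>d>0. \<forall>y. norm (y - x) < d \<longrightarrow> norm (f y - f x - G \<bullet> (y - x)) \<le> e * norm (y - x)"
      proof (intro exI[of _ \<delta>] conjI allI impI)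
        fix y assume "norm (y - x) < \<delta>"
        with \<delta>(2)[of "y - x"] have "norm (f y - f x - G \<bullet> (y - x)) \<le> ?c * inverse (real (Suc k)) * norm (y - x)"
          by simp
        also have "\<dots> \<le> e * norm (y - x)"
          using ce by (intro mult_right_mono) auto
        finally show "norm (f y - f x - G \<bullet> (y - x)) \<le> e * norm (y - x)" .
      qed (use \<delta> in auto)
    qed
    then show ?thesis by (auto simp: differentiable_def)
  qed
  ultimately show ?thesis
    by (elim negligible_subset) auto
qed

section \<open>Lipschitz functions on arbitrary subsets\<close>

text \<open>This is McShane's extension: the infimum over \<open>a\<close> in \<open>S\<close> of
  the cones \<open>f a + L * dist x a\<close>.\<close>

lemma lipschitz_extend_real:
  fixes f :: "'a::metric_space \<Rightarrow> real"
  assumes lip: "L-lipschitz_on S f"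
  shows "\<exists>g. L-lipschitz_on UNIV g \<and> (\<forall>x\<in>S. g x = f x)"
proof (cases "S = {}")
  case True
  then show ?thesis
    using lipschitz_on_nonneg[OF lip] by (intro exI[of _ "\<lambda>_. 0"]) (simp add: lipschitz_on_def)
next
  case False
  have "L \<ge> 0" using lip by (rule lipschitz_on_nonneg)
  define X where "X x = (\<lambda>a. f a + L * dist x a) ` S" for x
  define g where "g x = Inf (X x)" for x
  obtain c where c: "c \<in> S" using False by blast
  have bdd: "bdd_below (X x)" for x
  proof (rule bdd_belowI)
    fix y assume "y \<in> X x"
    then obtain a where a: "a \<in> S" "y = f a + L * dist x a" unfolding X_def by blast
    have "f c - f a \<le> L * dist c a"
      using lipschitz_onD[OF lip c a(1)] by (simp add: dist_real_def)
    also have "\<dots> \<le> L * (dist x c + dist x a)"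
      using \<open>L \<ge> 0\<close> by (intro mult_left_mono dist_triangle3)
    finally show "f c - L * dist x c \<le> y"
      unfolding a by (simp add: algebra_simps)
  qed
  have ne: "X x \<noteq> {}" for x using c unfolding X_def by blast
  have le: "g x \<le> g y + L * dist x y" for x y
  proof -
    have "g x - L * dist x y \<le> g y"
      unfolding g_def[of y]
    proof (rule cInf_greatest[OF ne])
      fix v assume "v \<in> X y"
      then obtain a where a: "a \<in> S" "v = f a + L * dist y a" unfolding X_def by blast
      have "g x \<le> f a + L * dist x a"
        unfolding g_def using a bdd by (intro cInf_lower) (auto simp: X_def)
      also have "L * dist x a \<le> L * (dist x y + dist y a)"
        using \<open>L \<ge> 0\<close> by (intro mult_left_mono dist_triangle)
      finally show "g x - L * dist x y \<le> v"
        unfolding a by (simp add: algebra_simps)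
    qed
    then show ?thesis by simp
  qed
  have "L-lipschitz_on UNIV g"
  proof (rule lipschitz_onI)
    fix x y show "dist (g x) (g y) \<le> L * dist x y"
      using le[of x y] le[of y x] by (simp add: dist_real_def dist_commute)
  qed (rule \<open>L \<ge> 0\<close>)
  moreover have "g x = f x" if "x \<in> S" for x
  proof (rule antisym)
    have "g x \<le> f x + L * dist x x"
      unfolding g_def using that bdd by (intro cInf_lower) (unfold X_def, rule imageI)
    then show "g x \<le> f x" by simp
    show "f x \<le> g x"
      unfolding g_def
    proof (rule cInf_greatest[OF ne])
      fix v assume "v \<in> X x"
      then obtain a where a: "a \<in> S" "v = f a + L * dist x a" unfolding X_def by blast
      then show "f x \<le> v"
        using lipschitz_onD[OF lip that a(1)] by (simp add: dist_real_def)
    qed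
  qed
  ultimately show ?thesis by blast
qed

text \<open>Each component is extended to the whole space. Differentiability of the extensions at
  \<open>x\<close> restricts to \<open>S\<close>, where they agree with the components of
  \<open>f\<close>. No measurability of \<open>S\<close> is required.\<close>

theorem Rademacher_on:
  fixes f :: "'a::euclidean_space \<Rightarrow> 'b::euclidean_space"
  assumes lip: "L-lipschitz_on S f"
  shows "negligible {x\<in>S. \<not> f differentiable (at x within S)}"
proof -
  have "\<exists>g. L-lipschitz_on UNIV g \<and> (\<forall>x\<in>S. g x = f x \<bullet> b)" if "b \<in> Basis" for b
  proof -
    have "L-lipschitz_on S (\<lambda>x. f x \<bullet> b)"
    proof (rule lipschitz_onI)
      fix x y assume "x \<in> S" "y \<in> S"
      have "dist (f x \<bullet> b) (f y \<bullet> b) \<le> dist (f x) (f y)"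
        using Basis_le_norm[OF that, of "f x - f y"] by (simp add: dist_norm inner_diff_left)
      also have "\<dots> \<le> L * dist x y"
        using lip \<open>x \<in> S\<close> \<open>y \<in> S\<close> by (rule lipschitz_onD)
      finally show "dist (f x \<bullet> b) (f y \<bullet> b) \<le> L * dist x y" .
    qed (rule lipschitz_on_nonneg[OF lip])
    then show ?thesis by (rule lipschitz_extend_real)
  qed
  then have "\<forall>b\<in>Basis. \<exists>g. L-lipschitz_on UNIV g \<and> (\<forall>x\<in>S. g x = f x \<bullet> b)"
    by blast
  from bchoice[OF this]
  obtain g where g: "\<And>b. b \<in> Basis \<Longrightarrow> L-lipschitz_on UNIV (g b)" "\<And>b x. b \<in> Basis \<Longrightarrow> x \<in> S \<Longrightarrow> g b x = f x \<bullet> b"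
    by auto
  have "negligible (\<Union>b\<in>Basis. {x. \<not> g b differentiable at x})"
    using Rademacher_real[OF g(1)] by auto
  moreover have "f differentiable (at x within S)" if "x \<in> S" "\<And>b. b \<in> Basis \<Longrightarrow> g b differentiable at x" for x
  proof -
    have "(\<lambda>x. f x \<bullet> b) differentiable (at x within S)" if b: "b \<in> Basis" for b
    proof -
      have "g b differentiable (at x within S)"
        using \<open>\<And>b. b \<in> Basis \<Longrightarrow> g b differentiable at x\<close>[OF b] by (rule differentiable_at_withinI)
      then show ?thesis
        by (rule differentiable_transform_within[OF _ zero_less_one \<open>x \<in> S\<close>]) (use g(2) b in auto)
    qed
    then show ?thesis by (subst differentiable_componentwise_within) auto
  qed
  ultimately show ?thesis
    by (elim negligible_subset) auto
qed

section \<open>Sheets of multi-valued functions\<close>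

text \<open>Finiteness makes the \<open>Min\<close> in \<open>Gdist\<close> a genuine minimum,
  attained and below every candidate.\<close>

lemma finite_orderings: "finite {(xs, ys). mset xs = P \<and> mset ys = R}"
proof -
  have "finite ({xs. mset xs = P} \<times> {ys. mset ys = R})"
    by (intro finite_cartesian_product; metis ex_mset mset_eq_finite)
  then show ?thesis by (rule rev_finite_subset) auto
qed

lemma matching_cost_eq:
  fixes xs ys :: "'a::real_normed_vector list"
  assumes "length xs = Q" "length ys = Q"
  shows "sqrt (sum_list (map (\<lambda>(a, b). (norm (a - b))\<^sup>2) (zip xs ys))) = L2_set (\<lambda>i. norm (xs ! i - ys ! i)) {..<Q}"
  using assms by (simp add: sum_list_sum_nth L2_set_def atLeast0LessThan)

text \<open>Matching equal indices is one candidate, and the Euclidean norm is at most the sum of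
  the entries.\<close>

lemma Gdist_le_sum:
  fixes X Y :: "nat \<Rightarrow> 'a::real_normed_vector"
  shows "Gdist (mset (map X [0..<Q])) (mset (map Y [0..<Q])) \<le> (\<Sum>i<Q. norm (X i - Y i))"
proof -
  let ?xs = "map X [0..<Q]" and ?ys = "map Y [0..<Q]"
  have "Gdist (mset ?xs) (mset ?ys) \<le> sqrt (sum_list (map (\<lambda>(a, b). (norm (a - b))\<^sup>2) (zip ?xs ?ys)))"
    unfolding Gdist_def by (intro Min_le finite_imageI finite_orderings) force
  also have "\<dots> = L2_set (\<lambda>i. norm (X i - Y i)) {..<Q}"
    by (subst matching_cost_eq[of _ Q]) (auto intro: L2_set_cong)
  also have "\<dots> \<le> (\<Sum>i<Q. norm (X i - Y i))"
    by (intro L2_set_le_sum) auto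
  finally show ?thesis .
qed

text \<open>An optimal matching can be read off along any prescribed enumeration \<open>X\<close> of
  the second argument, and each matched pair is at most the total distance apart.\<close>

lemma Gdist_matching:
  fixes X :: "nat \<Rightarrow> 'a::real_normed_vector"
  assumes "size R = Q"
  shows "\<exists>Y. R = mset (map Y [0..<Q]) \<and> (\<forall>i<Q. norm (Y i - X i) \<le> Gdist R (mset (map X [0..<Q])))"
proof -
  let ?P = "mset (map X [0..<Q])"
  let ?c = "\<lambda>(xs, ys). sqrt (sum_list (map (\<lambda>(a, b). (norm (a - b))\<^sup>2) (zip xs ys)))"
  obtain rs where "mset rs = R" using ex_mset by blast
  then have "(rs, map X [0..<Q]) \<in> {(xs, ys). mset xs = R \<and> mset ys = ?P}"
    by simp
  then have "Gdist R ?P \<in> ?c ` {(xs, ys). mset xs = R \<and> mset ys = ?P}"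
    unfolding Gdist_def by (intro Min_in finite_imageI finite_orderings) blast
  then obtain xs ys where xy: "mset xs = R" "mset ys = ?P" "Gdist R ?P = ?c (xs, ys)"
    by auto
  have len: "length xs = Q" "length ys = Q"
    using xy assms by (auto simp flip: size_mset)
  \<comment> \<open>Permuting both lists of an optimal pair simultaneously preserves the pairing and
    brings the second list into the prescribed order.\<close>
  obtain \<pi> where \<pi>: "\<pi> permutes {..<length ys}" "permute_list \<pi> ys = map X [0..<Q]"
    using mset_eq_permutation[OF xy(2)[symmetric]] by blast
  define Y where "Y i = xs ! \<pi> i" for i
  have "map Y [0..<Q] = permute_list \<pi> xs"
    unfolding permute_list_def Y_def len ..
  then have "R = mset (map Y [0..<Q])"
    using \<pi>(1) xy(1) len by simp
  moreover have "norm (Y i - X i) \<le> Gdist R ?P" if "i < Q" for i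
  proof -
    have "X i = ys ! \<pi> i"
      using permute_list_nth[OF \<pi>(1), of i] \<pi>(2) that len by simp
    moreover have "\<pi> i \<in> {..<Q}"
      using permutes_in_image[OF \<pi>(1), of i] that len by simp
    ultimately show ?thesis
      unfolding xy(3) Y_def prod.case matching_cost_eq[OF len]
      using member_le_L2_set[of "{..<Q}" "\<pi> i" "\<lambda>i. norm (xs ! i - ys ! i)"] by simp
  qed
  ultimately show ?thesis by blast
qed

lemma Gdist_nonneg: "0 \<le> Gdist P R"
proof -
  obtain xs ys where "mset xs = P" "mset ys = R" using ex_mset by metis
  then show ?thesis
    unfolding Gdist_def by (subst Min_ge_iff[OF finite_imageI[OF finite_orderings]])
      (auto intro!: sum_list_nonneg)
qed

lemma Gdist_self: "Gdist P P = 0"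
proof -
  obtain xs where xs: "mset xs = P" using ex_mset by blast
  have P: "P = mset (map ((!) xs) [0..<length xs])"
    by (simp add: map_nth xs)
  have "Gdist P P \<le> (\<Sum>i<length xs. norm (xs ! i - xs ! i))"
    unfolding P by (rule Gdist_le_sum)
  then show ?thesis using Gdist_nonneg[of P P] by simp
qed

section \<open>Lipschitz sheets on small pieces\<close>

text \<open>One parameter serves as Lipschitz constant and as inverse radius, so integer values of
  \<open>j\<close> suffice. The point \<open>y\<close> ranges over all of \<open>B\<close>, which
  later carries expansions from a piece back to \<open>B\<close>.\<close>

definition lip_at_scale :: "real \<Rightarrow> 'n::euclidean_space set \<Rightarrow> ('n \<Rightarrow> 'k::euclidean_space multiset) \<Rightarrow> 'n set" where
  "lip_at_scale j B f = {x\<in>B. \<forall>y\<in>B. norm (y - x) < inverse j \<longrightarrow> Gdist (f y) (f x) \<le> j * norm (y - x)}"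

text \<open>The list \<open>cs\<close> names the \<open>Q\<close> sheets of \<open>f\<close> near \<open>x\<close>: its distinct entries correspond to the distinct
  points of \<open>f x\<close>, and repetitions record multiplicities.\<close>
definition split_near :: "'k::euclidean_space list \<Rightarrow> real \<Rightarrow> ('n \<Rightarrow> 'k multiset) \<Rightarrow> 'n set" where
  "split_near cs r f = {x. \<exists>p. f x = mset (map p cs) \<and> (\<forall>c\<in>set cs. norm (p c - c) < r)}"

lemma map_nth_conv: "map g cs = map (\<lambda>i. g (cs ! i)) [0..<length cs]"
  by (rule nth_equalityI) auto

text \<open>An optimal matching sends \<open>\<eta> y c\<close> to a point
  \<open>\<eta> x c'\<close> at distance at most \<open>j * norm (x - y)\<close>, which is below
  \<open>2 * r\<close>. If \<open>c'\<close> differed from \<open>c\<close>, their distance would be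
  less than \<open>r + 2 * r + r\<close>, against the separation \<open>4 * r\<close>. So the
  matching respects the sheets.\<close>

lemma lipschitz_sheets:
  fixes f :: "'n::euclidean_space \<Rightarrow> 'k::euclidean_space multiset"
  assumes S: "S \<subseteq> lip_at_scale j B f" and "0 \<le> j"
    and sep: "\<And>c c'. c \<in> set cs \<Longrightarrow> c' \<in> set cs \<Longrightarrow> c \<noteq> c' \<Longrightarrow> 4 * r \<le> norm (c - c')"
    and small: "\<And>x y. x \<in> S \<Longrightarrow> y \<in> S \<Longrightarrow> norm (x - y) < inverse j \<and> j * norm (x - y) < 2 * r"
    and \<eta>: "\<And>x. x \<in> S \<Longrightarrow> f x = mset (map (\<eta> x) cs)"
      "\<And>x c. x \<in> S \<Longrightarrow> c \<in> set cs \<Longrightarrow> norm (\<eta> x c - c) < r"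
    and c: "c \<in> set cs"
  shows "j-lipschitz_on S (\<lambda>x. \<eta> x c)"
proof (rule lipschitz_onI[OF _ \<open>0 \<le> j\<close>])
  fix x y assume xy: "x \<in> S" "y \<in> S"
  obtain i where i: "i < length cs" "c = cs ! i"
    using c by (auto simp: in_set_conv_nth)
  have "Gdist (f x) (f y) \<le> j * norm (x - y)"
    using S small[OF xy] xy by (auto simp: lip_at_scale_def)
  moreover obtain X where X: "f x = mset (map X [0..<length cs])"
      "\<And>i. i < length cs \<Longrightarrow> norm (X i - \<eta> y (cs ! i)) \<le> Gdist (f x) (f y)"
    using Gdist_matching[of "f x" "length cs" "\<lambda>i. \<eta> y (cs ! i)"] \<eta>(1)[OF xy(1)] \<eta>(1)[OF xy(2)]
    by (auto simp flip: map_nth_conv)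
  ultimately have Xi: "norm (X i - \<eta> y c) \<le> j * norm (x - y)"
    using i by fastforce
  have "X i \<in> set_mset (f x)"
    using X(1) i(1) by simp
  then obtain c' where c': "c' \<in> set cs" "X i = \<eta> x c'"
    unfolding \<eta>(1)[OF xy(1)] by auto
  have "c' = c"
  proof (rule ccontr)
    assume "c' \<noteq> c"
    then have "4 * r \<le> norm (c' - c)"
      using sep c c'(1) by blast
    also have "c' - c = (c' - \<eta> x c') + (\<eta> x c' - \<eta> y c) + (\<eta> y c - c)"
      by simp
    also have "norm \<dots> \<le> norm (c' - \<eta> x c') + norm (\<eta> x c' - \<eta> y c) + norm (\<eta> y c - c)"
      by (intro norm_triangle_le add_mono order_refl norm_triangle_ineq)
    also have "\<dots> < r + 2 * r + r"
      using \<eta>(2)[OF xy(1) c'(1)] \<eta>(2)[OF xy(2) c] Xi small[OF xy] c'(2)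
      by (intro add_strict_mono) (auto simp: norm_minus_commute)
    finally show False by simp
  qed
  with Xi c' show "dist (\<eta> x c) (\<eta> y c) \<le> j * dist x y"
    by (simp add: dist_norm)
qed

text \<open>For \<open>y\<close> in \<open>B\<close>, nonporosity supplies \<open>z\<close> in
  \<open>S\<close> very close to \<open>y\<close>. Matching \<open>f y\<close> with
  \<open>f z\<close> and expanding the sheets at \<open>z\<close> gives an expansion at
  \<open>y\<close> whose error is small compared with \<open>norm (y - x)\<close>.\<close>

lemma sheets_approx:
  fixes f :: "'n::euclidean_space \<Rightarrow> 'k::euclidean_space multiset"
  assumes S: "S \<subseteq> lip_at_scale j B f" and "0 < j"
    and size: "\<And>y. y \<in> B \<Longrightarrow> size (f y) = length cs"
    and \<eta>: "\<And>x. x \<in> S \<Longrightarrow> f x = mset (map (\<eta> x) cs)"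
    and D: "\<And>c. c \<in> set cs \<Longrightarrow> ((\<lambda>x. \<eta> x c) has_derivative D c) (at x within S)"
    and np: "nonporous_at S x"
  shows "((\<lambda>y. Gdist (f y) (mset (map (\<lambda>c. \<eta> x c + D c (y - x)) cs)) / norm (y - x)) \<longlongrightarrow> 0) (at x within B)"
proof (rule tendstoI)
  fix e :: real assume "e > 0"
  let ?Q = "length cs"
  have lin: "bounded_linear (D c)" if "c \<in> set cs" for c
    using D[OF that] by (rule has_derivative_bounded_linear)
  define K where "K = (\<Sum>c\<in>set cs. onorm (D c))"
  have K0: "0 \<le> K"
    unfolding K_def using lin by (intro sum_nonneg onorm_pos_le)
  have K: "norm (D c h) \<le> K * norm h" if "c \<in> set cs" for c h
  proof -
    have "norm (D c h) \<le> onorm (D c) * norm h"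
      by (rule onorm[OF lin[OF that]])
    also have "onorm (D c) \<le> K"
      unfolding K_def using that lin by (intro member_le_sum onorm_pos_le) auto
    finally show ?thesis by (simp add: mult_right_mono)
  qed
  \<comment> \<open>Per sheet, in units of \<open>\<epsilon> * norm (y - x)\<close>:
    \<open>j\<close> for matching \<open>f y\<close> to \<open>f z\<close>, \<open>2\<close> for the
    remainder at \<open>z\<close> since \<open>norm (z - x)\<close> is at most twice
    \<open>norm (y - x)\<close>, and \<open>K\<close> for the linear term at \<open>z - y\<close>.
    The final \<open>1\<close> keeps \<open>C\<close> positive for an empty list.\<close>
  define C where "C = real ?Q * (j + 2 + K) + 1"
  have "C > 0" unfolding C_def using \<open>0 < j\<close> K0 by (intro add_nonneg_pos mult_nonneg_nonneg) auto
  define \<epsilon> where "\<epsilon> = min 1 (e / (2 * C))"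
  have \<epsilon>: "0 < \<epsilon>" "\<epsilon> \<le> 1" "C * \<epsilon> < e"
    using \<open>e > 0\<close> \<open>C > 0\<close> by (auto simp: \<epsilon>_def min_def field_simps)
  have "\<forall>\<^sub>F z in at x within S. \<forall>c\<in>set cs. norm (\<eta> z c - \<eta> x c - D c (z - x)) \<le> \<epsilon> * norm (z - x)"
    using D \<epsilon>(1) unfolding has_derivative_within_alt2 by (intro eventually_ball_finite) auto
  then obtain d1 where d1: "d1 > 0" "\<And>z c. z \<in> S \<Longrightarrow> z \<noteq> x \<Longrightarrow> dist z x < d1 \<Longrightarrow> c \<in> set cs \<Longrightarrow>
      norm (\<eta> z c - \<eta> x c - D c (z - x)) \<le> \<epsilon> * norm (z - x)"
    unfolding eventually_at by blast
  \<comment> \<open>The point \<open>z\<close> found by nonporosity may be \<open>x\<close> itself,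
    which the filter leaves out; there both sides vanish.\<close>
  have d1': "norm (\<eta> z c - \<eta> x c - D c (z - x)) \<le> \<epsilon> * norm (z - x)" if "z \<in> S" "dist z x < d1" "c \<in> set cs" for z c
    using d1(2)[OF that(1) _ that(2,3)] linear_0[OF bounded_linear.linear[OF lin[OF that(3)]]]
    by (cases "z = x") auto
  obtain d2 where d2: "d2 > 0" "\<And>y. dist y x < d2 \<Longrightarrow> \<exists>z\<in>S. dist z y \<le> \<epsilon> * dist y x"
    using np \<epsilon>(1) unfolding nonporous_at_def by blast
  \<comment> \<open>The half in \<open>d1 / 2\<close> allows for \<open>z\<close> being up to twice
    as far from \<open>x\<close> as \<open>y\<close> is; \<open>inverse j\<close> brings
    \<open>y\<close> into the range of the Lipschitz bound at \<open>z\<close>.\<close>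
  define d where "d = min (d1 / 2) (min d2 (inverse j))"
  have "d > 0" using d1(1) d2(1) \<open>0 < j\<close> by (simp add: d_def)
  have "Gdist (f y) (mset (map (\<lambda>c. \<eta> x c + D c (y - x)) cs)) / norm (y - x) < e"
    if y: "y \<in> B" "y \<noteq> x" "dist y x < d" for y
  proof -
    define s where "s = norm (y - x)"
    have "s > 0" using y by (simp add: s_def)
    obtain z where z: "z \<in> S" "norm (z - y) \<le> \<epsilon> * s"
      using d2(2)[of y] y(3) by (auto simp: d_def dist_norm s_def)
    have es: "\<epsilon> * s \<le> s"
      using \<epsilon>(2) \<open>s > 0\<close> by simp
    have zx: "norm (z - x) \<le> 2 * s"
      using norm_triangle_ineq[of "z - y" "y - x"] z(2) es by (simp add: s_def)
    have zd: "dist z x < d1"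
      using zx y(3) by (simp add: d_def dist_norm s_def)
    have "norm (y - z) < inverse j"
      using z(2) es y(3) by (simp add: d_def dist_norm s_def norm_minus_commute)
    then have "Gdist (f y) (f z) \<le> j * norm (y - z)"
      using S z(1) y(1) by (auto simp: lip_at_scale_def)
    also have "\<dots> \<le> j * (\<epsilon> * s)"
      using z(2) \<open>0 < j\<close> by (simp add: norm_minus_commute)
    finally have G: "Gdist (f y) (f z) \<le> j * (\<epsilon> * s)" .
    obtain Y where Y: "f y = mset (map Y [0..<?Q])"
        "\<And>i. i < ?Q \<Longrightarrow> norm (Y i - \<eta> z (cs ! i)) \<le> Gdist (f y) (f z)"
      using Gdist_matching[of "f y" ?Q "\<lambda>i. \<eta> z (cs ! i)"] size[OF y(1)] \<eta>[OF z(1)]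
      by (auto simp flip: map_nth_conv)
    have sheet: "norm (Y i - (\<eta> x (cs ! i) + D (cs ! i) (y - x))) \<le> (j + 2 + K) * \<epsilon> * s" if i: "i < ?Q" for i
    proof -
      let ?c = "cs ! i"
      have c: "?c \<in> set cs" using i by simp
      have "norm (\<eta> z ?c - \<eta> x ?c - D ?c (z - x)) \<le> \<epsilon> * (2 * s)"
        using d1'[OF z(1) zd c] mult_left_mono[OF zx, of \<epsilon>] \<epsilon>(1) by linarith
      moreover have "norm (D ?c (z - y)) \<le> K * (\<epsilon> * s)"
        using K[OF c, of "z - y"] mult_left_mono[OF z(2) K0] by linarith
      moreover have "norm (Y i - \<eta> z ?c) \<le> j * (\<epsilon> * s)"
        using Y(2)[OF i] G by linarith
      moreover have "Y i - (\<eta> x ?c + D ?c (y - x)) = (Y i - \<eta> z ?c) + (\<eta> z ?c - \<eta> x ?c - D ?c (z - x)) + D ?c (z - y)"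
        using linear_diff[OF bounded_linear.linear[OF lin[OF c]]] by simp
      ultimately have "norm (Y i - (\<eta> x ?c + D ?c (y - x))) \<le> j * (\<epsilon> * s) + \<epsilon> * (2 * s) + K * (\<epsilon> * s)"
        by (smt (verit) norm_triangle_ineq)
      then show ?thesis by (simp add: algebra_simps)
    qed
    have "Gdist (f y) (mset (map (\<lambda>c. \<eta> x c + D c (y - x)) cs))
        \<le> (\<Sum>i<?Q. norm (Y i - (\<eta> x (cs ! i) + D (cs ! i) (y - x))))"
      unfolding Y(1) map_nth_conv[of _ cs] by (rule Gdist_le_sum)
    also have "\<dots> \<le> (\<Sum>i<?Q. (j + 2 + K) * \<epsilon> * s)"
      using sheet by (intro sum_mono) auto
    also have "\<dots> \<le> C * \<epsilon> * s"
      using \<epsilon>(1) \<open>s > 0\<close> by (simp add: C_def algebra_simps)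
    also have "\<dots> < e * s"
      using \<epsilon>(3) \<open>s > 0\<close> by simp
    finally show ?thesis
      using \<open>s > 0\<close> unfolding s_def[symmetric] by (simp add: divide_less_eq)
  qed
  then show "\<forall>\<^sub>F y in at x within B. dist (Gdist (f y) (mset (map (\<lambda>c. \<eta> x c + D c (y - x)) cs)) / norm (y - x)) 0 < e"
    unfolding eventually_at using \<open>d > 0\<close> by (intro exI[of _ d]) (auto simp: dist_real_def Gdist_nonneg)
qed

text \<open>The exceptional points are those where some sheet is not differentiable relative to
  \<open>S\<close> and the porous points of \<open>S\<close>. Injectivity of \<open>p\<close>, a
  consequence of the separation, is recorded because it makes the derivative depend only on the
  point of \<open>f x\<close>, as differentiability demands.\<close>

lemma negligible_nondifferentiable_piece:
  fixes f :: "'n::euclidean_space \<Rightarrow> 'k::euclidean_space multiset"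
  assumes S: "S \<subseteq> lip_at_scale j B f \<inter> split_near cs r f" and "0 < j"
    and size: "\<And>y. y \<in> B \<Longrightarrow> size (f y) = length cs"
    and sep: "\<And>c c'. c \<in> set cs \<Longrightarrow> c' \<in> set cs \<Longrightarrow> c \<noteq> c' \<Longrightarrow> 4 * r \<le> norm (c - c')"
    and small: "\<And>x y. x \<in> S \<Longrightarrow> y \<in> S \<Longrightarrow> norm (x - y) < inverse j \<and> j * norm (x - y) < 2 * r"
  shows "negligible {x\<in>S. \<not> (\<exists>p D. f x = mset (map p cs) \<and> inj_on p (set cs) \<and> (\<forall>c\<in>set cs. bounded_linear (D c)) \<and>
    ((\<lambda>y. Gdist (f y) (mset (map (\<lambda>c. p c + D c (y - x)) cs)) / norm (y - x)) \<longlongrightarrow> 0) (at x within B))}"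
proof -
  have "\<forall>x\<in>S. \<exists>p. f x = mset (map p cs) \<and> (\<forall>c\<in>set cs. norm (p c - c) < r)"
    using S by (auto simp: split_near_def)
  from bchoice[OF this] obtain \<eta> where \<eta>: "\<And>x. x \<in> S \<Longrightarrow> f x = mset (map (\<eta> x) cs)"
      "\<And>x c. x \<in> S \<Longrightarrow> c \<in> set cs \<Longrightarrow> norm (\<eta> x c - c) < r"
    by auto
  define N where "N = (\<Union>c\<in>set cs. {x\<in>S. \<not> (\<lambda>x. \<eta> x c) differentiable (at x within S)}) \<union> {x\<in>S. \<not> nonporous_at S x}"
  have "j-lipschitz_on S (\<lambda>x. \<eta> x c)" if "c \<in> set cs" for c
    using lipschitz_sheets[of S j B f cs r \<eta> c] S \<open>0 < j\<close> sep small \<eta> that by auto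
  then have "negligible N"
    unfolding N_def by (intro negligible_Un negligible_porous_points negligible_Union finite_imageI)
      (auto intro: Rademacher_on)
  moreover have "\<exists>p D. f x = mset (map p cs) \<and> inj_on p (set cs) \<and> (\<forall>c\<in>set cs. bounded_linear (D c)) \<and>
      ((\<lambda>y. Gdist (f y) (mset (map (\<lambda>c. p c + D c (y - x)) cs)) / norm (y - x)) \<longlongrightarrow> 0) (at x within B)"
    if x: "x \<in> S" "x \<notin> N" for x
  proof -
    have "\<forall>c\<in>set cs. \<exists>D. ((\<lambda>x. \<eta> x c) has_derivative D) (at x within S)"
      using x unfolding N_def differentiable_def by blast
    from bchoice[OF this] obtain D where D: "\<And>c. c \<in> set cs \<Longrightarrow> ((\<lambda>x. \<eta> x c) has_derivative D c) (at x within S)"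
      by auto
    have np: "nonporous_at S x"
      using x unfolding N_def by blast
    have "inj_on (\<eta> x) (set cs)"
    proof (rule inj_onI, rule ccontr)
      fix c c' assume c: "c \<in> set cs" "c' \<in> set cs" "\<eta> x c = \<eta> x c'" "c \<noteq> c'"
      have "norm (c - c') \<le> norm (\<eta> x c - c) + norm (\<eta> x c' - c')"
        using norm_triangle_ineq4[of "\<eta> x c' - c'" "\<eta> x c - c"] c(3) by simp
      then show False
        using \<eta>(2)[OF x(1) c(1)] \<eta>(2)[OF x(1) c(2)] sep[OF c(1,2,4)] norm_ge_zero[of "\<eta> x c - c"] by linarith
    qed
    moreover have "((\<lambda>y. Gdist (f y) (mset (map (\<lambda>c. \<eta> x c + D c (y - x)) cs)) / norm (y - x)) \<longlongrightarrow> 0) (at x within B)"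
      using S by (intro sheets_approx[OF _ \<open>0 < j\<close> size \<eta>(1) D np]) auto
    ultimately show ?thesis
      using \<eta>(1)[OF x(1)] D has_derivative_bounded_linear by blast
  qed
  ultimately show ?thesis
    by (elim negligible_subset) blast
qed

section \<open>Countable decomposition and conclusion\<close>

lemma lip_at_scale_exhaust:
  assumes "x \<in> B" "Lip_pt B f x < \<infinity>"
  shows "\<exists>n. x \<in> lip_at_scale (real (Suc n)) B f"
proof -
  obtain M where M: "Lip_pt B f x < ereal M"
    using assms(2) less_PInf_Ex_of_nat by auto
  have "\<forall>\<^sub>F y in at x within B. ereal (Gdist (f y) (f x) / norm (y - x)) < ereal M"
    using M unfolding Lip_pt_def by (rule Limsup_lessD)
  then obtain d where d: "d > 0" "\<And>y. y \<in> B \<Longrightarrow> y \<noteq> x \<Longrightarrow> dist y x < d \<Longrightarrow> Gdist (f y) (f x) / norm (y - x) < M"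
    unfolding eventually_at by auto
  obtain n where n: "max M (inverse d) < real n"
    using reals_Archimedean2 by blast
  have "inverse (real (Suc n)) < d"
    using n less_imp_inverse_less[of "inverse d" "real (Suc n)"] d(1) by simp
  moreover have "Gdist (f y) (f x) \<le> real (Suc n) * norm (y - x)" if "y \<in> B" "norm (y - x) < d" for y
  proof (cases "y = x")
    case False
    then have "Gdist (f y) (f x) \<le> M * norm (y - x)"
      using d(2)[OF that(1)] that(2) by (simp add: dist_norm field_simps)
    also have "\<dots> \<le> real (Suc n) * norm (y - x)"
      using n by (intro mult_right_mono) auto
    finally show ?thesis .
  qed (simp add: Gdist_self)
  ultimately have "x \<in> lip_at_scale (real (Suc n)) B f"
    using assms(1) unfolding lip_at_scale_def by auto
  then show ?thesis ..
qed

text \<open>Each distinct point of \<open>f x\<close> is moved to a nearby point of the dense set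
  \<open>D\<close>. Equal points move together, so multiplicities survive, and a small radius keeps
  distinct centres apart.\<close>

lemma split_near_exhaust:
  fixes f :: "'n \<Rightarrow> 'k::euclidean_space multiset" and D :: "'k set"
  assumes dense: "\<And>X. open X \<Longrightarrow> X \<noteq> {} \<Longrightarrow> \<exists>d\<in>D. d \<in> X"
  shows "\<exists>cs n. set cs \<subseteq> D \<and> length cs = size (f x) \<and> x \<in> split_near cs (inverse (real (Suc n))) f \<and>
    (\<forall>c\<in>set cs. \<forall>c'\<in>set cs. c \<noteq> c' \<longrightarrow> 4 * inverse (real (Suc n)) \<le> norm (c - c'))"
proof -
  obtain ps where ps: "mset ps = f x" using ex_mset by blast
  have "\<exists>\<delta>>0. \<forall>p\<in>set ps. \<forall>p'\<in>set ps. p \<noteq> p' \<longrightarrow> \<delta> \<le> norm (p - p')"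
  proof -
    \<comment> \<open>The extra element \<open>1\<close> gives a positive minimum also when no two
      distinct points exist.\<close>
    let ?X = "insert 1 ((\<lambda>(p, p'). norm (p - p')) ` {(p, p'). p \<in> set ps \<and> p' \<in> set ps \<and> p \<noteq> p'})"
    have "finite {(p, p'). p \<in> set ps \<and> p' \<in> set ps \<and> p \<noteq> p'}"
      by (rule finite_subset[of _ "set ps \<times> set ps"]) auto
    then have fin: "finite ?X" by simp
    have "Min ?X > 0"
      using fin by (subst Min_gr_iff) auto
    moreover have "Min ?X \<le> norm (p - p')" if "p \<in> set ps" "p' \<in> set ps" "p \<noteq> p'" for p p'
      using fin that by (intro Min_le) (auto intro!: image_eqI[of _ _ "(p, p')"])
    ultimately show ?thesis by blast
  qed
  then obtain \<delta> where \<delta>: "\<delta> > 0" "\<And>p p'. p \<in> set ps \<Longrightarrow> p' \<in> set ps \<Longrightarrow> p \<noteq> p' \<Longrightarrow> \<delta> \<le> norm (p - p')"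
    by blast
  \<comment> \<open>With \<open>r < \<delta> / 6\<close>, moving both points by less than
    \<open>r\<close> leaves a distance of more than \<open>6 * r - 2 * r = 4 * r\<close>.\<close>
  obtain n where n: "inverse (real (Suc n)) < \<delta> / 6"
    using reals_Archimedean[of "\<delta> / 6"] \<delta>(1) by auto
  define r where "r = inverse (real (Suc n))"
  have "r > 0" by (simp add: r_def)
  have "\<exists>d\<in>D. norm (p - d) < r" for p
    using dense[of "ball p r"] \<open>r > 0\<close> by (auto simp: dist_norm)
  then obtain near where near: "\<And>p. near p \<in> D" "\<And>p. norm (p - near p) < r"
    by metis
  have sep: "4 * r \<le> norm (near p - near p')" if "p \<in> set ps" "p' \<in> set ps" "p \<noteq> p'" for p p'
  proof -
    have "norm (p - p') = norm ((p - near p) + (near p - near p') + (near p' - p'))"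
      by simp
    also have "\<dots> \<le> norm (p - near p) + norm (near p - near p') + norm (near p' - p')"
      by (intro norm_triangle_le add_mono order_refl norm_triangle_ineq)
    finally show ?thesis
      using \<delta>(2)[OF that] n near(2)[of p] near(2)[of p'] unfolding r_def[symmetric]
      by (simp add: norm_minus_commute)
  qed
  define cs where "cs = map near ps"
  have inj: "inj_on near (set ps)"
    using sep \<open>r > 0\<close> by (force intro: inj_onI)
  have "map (the_inv_into (set ps) near) cs = ps"
    unfolding cs_def map_map by (intro map_idI) (simp add: the_inv_into_f_f[OF inj])
  then have "f x = mset (map (the_inv_into (set ps) near) cs)"
    using ps by simp
  moreover have "norm (the_inv_into (set ps) near c - c) < r" if "c \<in> set cs" for c
    using that near(2) by (auto simp: cs_def the_inv_into_f_f[OF inj])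
  ultimately have "x \<in> split_near cs r f"
    unfolding split_near_def by blast
  moreover have "length cs = size (f x)"
    using ps by (simp add: cs_def flip: size_mset)
  moreover have "set cs \<subseteq> D"
    using near(1) by (auto simp: cs_def)
  moreover have "\<forall>c\<in>set cs. \<forall>c'\<in>set cs. c \<noteq> c' \<longrightarrow> 4 * r \<le> norm (c - c')"
    using sep by (auto simp: cs_def)
  ultimately show ?thesis unfolding r_def by blast
qed

theorem theorem1p2:
  fixes Q :: nat
    and B :: "(real^'n) set"
    and f :: "real^'n \<Rightarrow> (real^'k) multiset"
  assumes "Q > 0"
    and "B \<in> sets lebesgue"
    and "\<forall>x\<in>B. x islimpt B"
    and "\<forall>x\<in>B. f x \<in> AQ Q"
    and "AQ_measurable Q B f"
  shows "AE x in lebesgue. x \<in> {x\<in>B. Lip_pt B f x < \<infinity>} \<longrightarrow> AQ_differentiable_at Q B f x"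
proof -
  obtain D1 :: "(real^'k) set" where D1: "countable D1" "\<And>X. open X \<Longrightarrow> X \<noteq> {} \<Longrightarrow> \<exists>d\<in>D1. d \<in> X"
    using countable_dense_exists by blast
  obtain D2 :: "(real^'n) set" where D2: "countable D2" "\<And>X. open X \<Longrightarrow> X \<noteq> {} \<Longrightarrow> \<exists>d\<in>D2. d \<in> X"
    using countable_dense_exists by blast
  have size: "size (f x) = Q" if "x \<in> B" for x
    using assms(4) that by (auto simp: AQ_def)
  define sepd where "sepd cs r \<longleftrightarrow> (\<forall>c\<in>set cs. \<forall>c'\<in>set cs. c \<noteq> c' \<longrightarrow> 4 * r \<le> norm (c - c'))"
    for cs :: "(real^'k) list" and r
  \<comment> \<open>Half of the smaller of \<open>1 / j\<close> and \<open>2 * r / j\<close>, where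
    \<open>j = Suc m\<close> and \<open>r = 1 / Suc n\<close>: any two points of a ball of this
    radius then satisfy both smallness conditions on a piece.\<close>
  define \<rho> where "\<rho> m n = min (inverse (real (Suc m))) (2 * inverse (real (Suc n)) / real (Suc m)) / 2" for m n
  \<comment> \<open>Inadmissible lists get the empty piece, so the union in \<open>N\<close> can run
    over all lists from \<open>D1\<close>, a countable set.\<close>
  define S where "S m n cs w = (if sepd cs (inverse (real (Suc n))) \<and> length cs = Q
    then lip_at_scale (real (Suc m)) B f \<inter> split_near cs (inverse (real (Suc n))) f \<inter> ball w (\<rho> m n) else {})" for m n cs w
  define N where "N = (\<Union>m. \<Union>n. \<Union>cs\<in>lists D1. \<Union>w\<in>D2. {x\<in>S m n cs w. \<not> AQ_differentiable_at Q B f x})"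
  have "negligible {x\<in>S m n cs w. \<not> AQ_differentiable_at Q B f x}" for m n cs w
  proof (cases "sepd cs (inverse (real (Suc n))) \<and> length cs = Q")
    case True
    define j where "j = real (Suc m)"
    define r where "r = inverse (real (Suc n))"
    have "j > 0" by (simp add: j_def)
    have S_eq: "S m n cs w = lip_at_scale j B f \<inter> split_near cs r f \<inter> ball w (\<rho> m n)"
      using True by (simp add: S_def j_def r_def)
    have small: "norm (x - y) < inverse j \<and> j * norm (x - y) < 2 * r" if "x \<in> S m n cs w" "y \<in> S m n cs w" for x y
    proof -
      have "dist w x < min (inverse j) (2 * r / j) / 2" "dist w y < min (inverse j) (2 * r / j) / 2"
        using that unfolding S_eq \<rho>_def j_def r_def Int_iff mem_ball by blast+
      then have "dist x y < min (inverse j) (2 * r / j)"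
        by (rule dist_triangle_half_r)
      then show ?thesis
        using \<open>j > 0\<close> by (simp add: dist_norm less_divide_eq mult.commute)
    qed
    show ?thesis
    proof (rule negligible_subset)
      show "negligible {x\<in>S m n cs w. \<not> (\<exists>p D. f x = mset (map p cs) \<and> inj_on p (set cs) \<and> (\<forall>c\<in>set cs. bounded_linear (D c)) \<and>
          ((\<lambda>y. Gdist (f y) (mset (map (\<lambda>c. p c + D c (y - x)) cs)) / norm (y - x)) \<longlongrightarrow> 0) (at x within B))}"
      proof (rule negligible_nondifferentiable_piece[OF _ \<open>j > 0\<close>])
        show "S m n cs w \<subseteq> lip_at_scale j B f \<inter> split_near cs r f"
          unfolding S_eq by blast
        show "4 * r \<le> norm (c - c')" if "c \<in> set cs" "c' \<in> set cs" "c \<noteq> c'" for c c'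
          using True that unfolding sepd_def r_def by blast
      qed (use True size small in auto)
      have "AQ_differentiable_at Q B f x" if p: "f x = mset (map p cs)" "inj_on p (set cs)"
          and D: "\<forall>c\<in>set cs. bounded_linear (D c)"
          and lim: "((\<lambda>y. Gdist (f y) (mset (map (\<lambda>c. p c + D c (y - x)) cs)) / norm (y - x)) \<longlongrightarrow> 0) (at x within B)"
        for x p D
      proof -
        \<comment> \<open>The sheets are renumbered by list positions and their derivatives written
          as matrices. Equal points at two positions come from the same centre, by injectivity of
          \<open>p\<close>, hence carry the same matrix.\<close>
        have eq: "map (\<lambda>c. p c + D c h) cs = map (\<lambda>i. p (cs ! i) + matrix (D (cs ! i)) *v h) [0..<Q]" for h
          using True D by (intro nth_equalityI) (auto simp: matrix_vector_mul(3)[THEN fun_cong])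
        show ?thesis
          unfolding AQ_differentiable_at_def
        proof (intro exI conjI allI impI)
          show "f x = mset (map (\<lambda>i. p (cs ! i)) [0..<Q])"
            using p(1) True map_nth_conv[of p cs] by simp
          show "((\<lambda>y. Gdist (f y) (mset (map (\<lambda>i. p (cs ! i) + matrix (D (cs ! i)) *v (y - x)) [0..<Q])) / norm (y - x))
              \<longlongrightarrow> 0) (at x within B)"
            using lim[unfolded eq] .
          fix i l assume "i < Q" "l < Q" "p (cs ! i) = p (cs ! l)"
          then show "matrix (D (cs ! i)) = matrix (D (cs ! l))"
            using inj_onD[OF p(2), of "cs ! i" "cs ! l"] True by simp
        qed
      qed
      then show "{x\<in>S m n cs w. \<not> AQ_differentiable_at Q B f x} \<subseteq>
        {x\<in>S m n cs w. \<not> (\<exists>p D. f x = mset (map p cs) \<and> inj_on p (set cs) \<and> (\<forall>c\<in>set cs. bounded_linear (D c)) \<and>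
          ((\<lambda>y. Gdist (f y) (mset (map (\<lambda>c. p c + D c (y - x)) cs)) / norm (y - x)) \<longlongrightarrow> 0) (at x within B))}"
        by blast
    qed
  next
    case False
    then have "S m n cs w = {}"
      unfolding S_def by (rule if_not_P)
    then show ?thesis by simp
  qed
  then have "negligible N"
    unfolding N_def using D1(1) D2(1)
    by (auto intro!: negligible_countable_Union countable_image countable_lists)
  moreover have "x \<in> N" if x: "x \<in> B" "Lip_pt B f x < \<infinity>" "\<not> AQ_differentiable_at Q B f x" for x
  proof -
    obtain m where m: "x \<in> lip_at_scale (real (Suc m)) B f"
      using lip_at_scale_exhaust[OF x(1,2)] by blast
    obtain cs n where cs: "set cs \<subseteq> D1" "length cs = Q" "x \<in> split_near cs (inverse (real (Suc n))) f"
        "sepd cs (inverse (real (Suc n)))"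
      using split_near_exhaust[of D1 f x] D1(2) size[OF x(1)] unfolding sepd_def by metis
    have "\<rho> m n > 0" by (simp add: \<rho>_def)
    then obtain w where w: "w \<in> D2" "w \<in> ball x (\<rho> m n)"
      using D2(2)[of "ball x (\<rho> m n)"] by auto
    have "x \<in> S m n cs w"
      using m cs w by (simp add: S_def dist_commute)
    then show ?thesis
      unfolding N_def using x(3) cs(1) w(1) by (auto simp: in_lists_conv_set)
  qed
  ultimately have "negligible {x. \<not> (x \<in> {x\<in>B. Lip_pt B f x < \<infinity>} \<longrightarrow> AQ_differentiable_at Q B f x)}"
    by (elim negligible_subset) auto
  then show ?thesis
    by (intro AE_I'[of "{x. \<not> (x \<in> {x\<in>B. Lip_pt B f x < \<infinity>} \<longrightarrow> AQ_differentiable_at Q B f x)}"])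
      (auto simp: negligible_iff_null_sets)
qed

end
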